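(* Let $\theta\in H^\infty$ be inner, let $\phi,\psi\in L^\infty$ be unimodular with $\overline\psi\phi=A_-\overline\theta+A_+\theta$ for some $A_+\in H^\infty$, $A_-\in\overline{H^\infty}$, such that neither $\phi\overline\psi$ nor $\overline\phi\psi$ is a constant multiple of $\theta$. Write $a=\overline{A_+(0)}$, $b=\overline{\overline{A_-}(0)}$, $t=\overline{\theta(0)}$, and $$\Delta_\lambda=\theta(\lambda)^2-ab\,(1-t\,\theta(\lambda))^2,\qquad \Delta=1-ab\,t^2,$$ $$\mathcal G_\lambda=\begin{pmatrix}\overline\theta&0&0&0\\0&\overline\theta&0&0\\ z-\lambda&(z-\lambda)\overline{A_+}\,\overline\theta&\theta&0\\ (z-\lambda)A_-\overline\theta&z-\lambda&0&\theta\end{pmatrix}.$$ If $\lambda\in\mathbb D$ or $\lambda\in\mathbb T_{\mathrm{ADC}}\setminus\sigma(\theta)$, and $\Delta_\lambda\ne0$, then $\mathcal G_\lambda$ admits a bounded canonical factorization $\mathcal G_\lambda=\mathcal G_{\lambda-}\mathcal G_{\lambda+}$, where: (i) if $\Delta\ne0$, $$\mathcal G_{\lambda+}^{-1}=\begin{pmatrix}\theta+\frac{abt}{\Delta}&\frac{\theta-\theta(\lambda)}{z-\lambda}&-\frac a\Delta&0\\ -\frac b\Delta&0&\theta+\frac{abt}{\Delta}&\frac{\theta-\theta(\lambda)}{z-\lambda}\\ -(z-\lambda)&-1&0&0\\0&0&-(z-\lambda)&-1\end{pmatrix},$$ $$\mathcal G_{\lambda-}=\begin{pmatrix}1+\frac{abt}{\Delta}\overline\theta&\frac{1-\theta(\lambda)\overline\theta}{z-\lambda}&-\frac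 a\Delta\overline\theta&0\\ -\frac b\Delta\overline\theta&0&1+\frac{abt}{\Delta}\overline\theta&\frac{1-\theta(\lambda)\overline\theta}{z-\lambda}\\ g^-_{31}&-\theta(\lambda)&g^-_{33}&\overline{A_+}(1-\theta(\lambda)\overline\theta)\\ g^-_{41}&A_-(1-\theta(\lambda)\overline\theta)&g^-_{43}&-\theta(\lambda)\end{pmatrix},$$ with $$g^-_{31}=-\tfrac b\Delta(z-\lambda)(\overline{A_+}\,\overline\theta-at),\qquad g^-_{41}=\tfrac{z-\lambda}{\Delta}\bigl(A_--b+abt\,A_-(\overline\theta-t)\bigr),$$ $$g^-_{33}=\tfrac{z-\lambda}{\Delta}\bigl(\overline{A_+}-a+abt\,\overline{A_+}(\overline\theta-t)\bigr),\qquad g^-_{43}=-\tfrac a\Delta(z-\lambda)(A_-\overline\theta-bt);$$ in this case $\det\mathcal G_{\lambda+}^{-1}=\det\mathcal G_{\lambda-}=-\Delta_\lambda/\Delta\in\mathbb C\setminus\{0\}$. (ii) if $\Delta=0$ (in which case $A_+(0),\overline{A_-}(0),\theta(0)\ne0$ and $A_+(0)\theta(0)=\frac1{\overline{A_-}(0)\theta(0)}$), $$\mathcal G_{\lambda+}^{-1}=\begin{pmatrix}-a(1-t\theta)&\frac{\theta-\theta(\lambda)}{z-\lambda}&-at&0\\ \theta&0&1&\frac{\theta-\theta(\lambda)}{z-\lambda}\\ -ta(z-\lambda)&-1&0&0\\ -(z-\lambda)&0&0&-1\end{pmatrix},$$ $$\mathcal G_{\lambda-}=\begin{pmatrix}-a(\overline\theta-t)&\frac{1-\theta(\lambda)\overline\theta}{z-\lambda}&-at\,\overline\theta&0\\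 1&0&\overline\theta&\frac{1-\theta(\lambda)\overline\theta}{z-\lambda}\\ (\overline{A_+}-a)(z-\lambda)&-\theta(\lambda)&(\overline{A_+}\,\overline\theta-at)(z-\lambda)&\overline{A_+}(1-\theta(\lambda)\overline\theta)\\ -aA_-(\overline\theta-t)(z-\lambda)&A_-(1-\theta(\lambda)\overline\theta)&(1-at\,A_-\overline\theta)(z-\lambda)&-\theta(\lambda)\end{pmatrix},$$ with $\det\mathcal G_{\lambda+}^{-1}=\det\mathcal G_{\lambda-}=a(1-2t\,\theta(\lambda))=-\Delta_\lambda/b\in\mathbb C\setminus\{0\}$.
   Context: All function spaces are on the unit circle $\mathbb T$; $H^2,H^\infty$ are the Hardy spaces of the unit disc $\mathbb D$. $\overline{H^\infty}$ is the set of complex conjugates of functions in $H^\infty$; for $A_-\in\overline{H^\infty}$, $\overline{A_-}\in H^\infty$ and $\overline{A_-}(0)$ is the value at $0$ of its analytic extension to $\mathbb D$. An inner function $\theta$ has an angular derivative in the sense of Carathéodory (ADC) at $\lambda\in\mathbb T$ if the nontangential limit $\theta(\lambda)$ of $\theta(z)$ as $z\to\lambda$ exists with $|\theta(\lambda)|=1$ and $\frac{\theta(z)-\theta(\lambda)}{z-\lambda}$ has a (finite) nontangential limit at $\lambda$; $\mathbb T_{\mathrm{ADC}}$ is the set of such $\lambda\in\mathbb T$, and for these $\theta(\lambda)$ denotes the nontangential limit. $\sigma(\theta)=\{\lambda\in\mathbb T:\liminf_{z\to\lambda,\,z\in\mathbb D}|\theta(z)|=0\}$. A bounded canonical factorization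 of $\mathcal G\in(L^\infty)^{4\times4}$ is a factorization $\mathcal G=\mathcal G_-\mathcal G_+$ a.e. on $\mathbb T$ with $\mathcal G_-^{\pm1}\in(\overline{H^\infty})^{4\times4}$ and $\mathcal G_+^{\pm1}\in(H^\infty)^{4\times4}$. *)

theory Defs
  imports "HOL-Analysis.Analysis" "HOL-Complex_Analysis.Complex_Analysis"
begin

section \<open>The unit circle and nontangential limits\<close>

(* Arc length.  Completed, so that a function that agrees a.e. with a measurable one is measurable. *)
definition arc_measure :: "complex measure" where
  "arc_measure =
     completion (distr (lebesgue_on {0..<2 * pi}) (restrict_space borel (sphere 0 1)) cis)"

definition stolz_region :: "complex \<Rightarrow> real \<Rightarrow> complex set" where
  "stolz_region \<zeta> M = {z \<in> ball 0 1. cmod (z - \<zeta>) < M * (1 - cmod z)}"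

(* Limits along this filter are the limits that exist, with the same value, within every Stolz
   region at the boundary point; see tendsto_nontangential_iff. *)
definition nontangential :: "complex \<Rightarrow> complex filter" where
  "nontangential \<zeta> = (SUP M\<in>{1<..}. at \<zeta> within stolz_region \<zeta> M)"

lemma tendsto_nontangential_iff:
  "(f \<longlongrightarrow> l) (nontangential \<zeta>) \<longleftrightarrow> (\<forall>M>1. (f \<longlongrightarrow> l) (at \<zeta> within stolz_region \<zeta> M))"
  unfolding nontangential_def filterlim_def filtermap_SUP SUP_le_iff by auto

lemma nontangential_neq_bot:
  assumes "cmod \<zeta> = 1"
  shows "nontangential \<zeta> \<noteq> bot"
proof
  assume "nontangential \<zeta> = bot"
  then have "at \<zeta> within stolz_region \<zeta> 2 = bot"
    using SUP_upper[of 2 "{1<..}" "\<lambda>M. at \<zeta> within stolz_region \<zeta> M"]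
    by (simp add: nontangential_def le_bot)
  moreover have "\<zeta> islimpt stolz_region \<zeta> 2"
    unfolding islimpt_approachable
  proof (intro allI impI)
    fix e :: real
    assume "e > 0"
    define s where "s = min (1/2) (e/2)"
    have s: "0 < s" "s < 1" "s < e"
      using \<open>e > 0\<close> by (auto simp: s_def min_def)
    have n: "cmod (of_real (1 - s) * \<zeta>) = 1 - s"
      using s assms by (simp add: norm_mult del: of_real_diff)
    have d: "cmod (of_real (1 - s) * \<zeta> - \<zeta>) = s"
    proof -
      have "of_real (1 - s) * \<zeta> - \<zeta> = - (of_real s * \<zeta>)"
        by (simp add: algebra_simps)
      then show ?thesis using s assms by (simp add: norm_mult)
    qed
    have "of_real (1 - s) * \<zeta> \<in> stolz_region \<zeta> 2"
      using n d s by (simp add: stolz_region_def del: of_real_diff)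
    moreover have "of_real (1 - s) * \<zeta> \<noteq> \<zeta>" using d s by auto
    moreover have "dist (of_real (1 - s) * \<zeta>) \<zeta> < e" using d s by (simp add: dist_norm)
    ultimately show "\<exists>x'\<in>stolz_region \<zeta> 2. x' \<noteq> \<zeta> \<and> dist x' \<zeta> < e" by blast
  qed
  ultimately show False
    using trivial_limit_within by blast
qed

section \<open>Function spaces on the unit circle\<close>

(* Elements of these spaces are represented by functions on the plane of which only the values on
   the unit circle matter, and those only up to null sets of arc_measure. *)

definition Linf :: "(complex \<Rightarrow> complex) set" where
  "Linf = {f. f \<in> borel_measurable arc_measure \<and> (\<exists>C. AE \<zeta> in arc_measure. cmod (f \<zeta>) \<le> C)}"

definition analytic_extension :: "(complex \<Rightarrow> complex) \<Rightarrow> (complex \<Rightarrow> complex) \<Rightarrow> bool" where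
  "analytic_extension F f \<longleftrightarrow>
     F holomorphic_on ball 0 1 \<and> bounded (F ` ball 0 1) \<and>
     (AE \<zeta> in arc_measure. (F \<longlongrightarrow> f \<zeta>) (nontangential \<zeta>))"

definition Hinf :: "(complex \<Rightarrow> complex) set" where
  "Hinf = {f. \<exists>F. analytic_extension F f}"

definition conj_Hinf :: "(complex \<Rightarrow> complex) set" where
  "conj_Hinf = {f. (\<lambda>\<zeta>. cnj (f \<zeta>)) \<in> Hinf}"

(* A bounded analytic function in the disc is determined by its boundary values, so on the disc the
   result does not depend on the choice.  Only values on the disc are ever used. *)
definition disc_ext :: "(complex \<Rightarrow> complex) \<Rightarrow> complex \<Rightarrow> complex" where
  "disc_ext f = (SOME F. analytic_extension F f)"

definition unimodular :: "(complex \<Rightarrow> complex) \<Rightarrow> bool" where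
  "unimodular f \<longleftrightarrow> (AE \<zeta> in arc_measure. cmod (f \<zeta>) = 1)"

definition inner_function :: "(complex \<Rightarrow> complex) \<Rightarrow> bool" where
  "inner_function \<theta> \<longleftrightarrow> \<theta> \<in> Hinf \<and> unimodular \<theta>"

section \<open>Boundary behaviour of an inner function\<close>

definition value_at :: "(complex \<Rightarrow> complex) \<Rightarrow> complex \<Rightarrow> complex" where
  "value_at f \<xi> =
     (if \<xi> \<in> ball 0 1 then disc_ext f \<xi> else Lim (nontangential \<xi>) (disc_ext f))"

definition T_ADC :: "(complex \<Rightarrow> complex) \<Rightarrow> complex set" where
  "T_ADC \<theta> = {\<xi> \<in> sphere 0 1. \<exists>w d. (disc_ext \<theta> \<longlongrightarrow> w) (nontangential \<xi>) \<and> cmod w = 1 \<and>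
     ((\<lambda>z. (disc_ext \<theta> z - w) / (z - \<xi>)) \<longlongrightarrow> d) (nontangential \<xi>)}"

definition boundary_spectrum :: "(complex \<Rightarrow> complex) \<Rightarrow> complex set" where
  "boundary_spectrum \<theta> =
     {\<xi> \<in> sphere 0 1. Liminf (at \<xi> within ball 0 1) (\<lambda>z. ereal (cmod (disc_ext \<theta> z))) = 0}"

section \<open>Bounded canonical factorizations\<close>

lemma vector_4 [simp]:
  "(vector [w, x, y, z] :: 'a::zero ^ 4) $ 1 = w"
  "(vector [w, x, y, z] :: 'a::zero ^ 4) $ 2 = x"
  "(vector [w, x, y, z] :: 'a::zero ^ 4) $ 3 = y"
  "(vector [w, x, y, z] :: 'a::zero ^ 4) $ 4 = z"
  unfolding vector_def by simp_all

definition entries_in :: "(complex \<Rightarrow> complex) set \<Rightarrow> (complex \<Rightarrow> complex ^ 4 ^ 4) \<Rightarrow> bool" where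
  "entries_in S G \<longleftrightarrow> (\<forall>i j. (\<lambda>\<zeta>. G \<zeta> $ i $ j) \<in> S)"

definition bounded_canonical_factorization ::
  "(complex \<Rightarrow> complex ^ 4 ^ 4) \<Rightarrow> (complex \<Rightarrow> complex ^ 4 ^ 4) \<Rightarrow> (complex \<Rightarrow> complex ^ 4 ^ 4) \<Rightarrow> bool"
where
  "bounded_canonical_factorization G Gm Gp \<longleftrightarrow>
     entries_in Linf G \<and>
     (AE \<zeta> in arc_measure. G \<zeta> = Gm \<zeta> ** Gp \<zeta>) \<and>
     (AE \<zeta> in arc_measure. invertible (Gm \<zeta>) \<and> invertible (Gp \<zeta>)) \<and>
     entries_in conj_Hinf Gm \<and> entries_in conj_Hinf (\<lambda>\<zeta>. matrix_inv (Gm \<zeta>)) \<and>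
     entries_in Hinf Gp \<and> entries_in Hinf (\<lambda>\<zeta>. matrix_inv (Gp \<zeta>))"

end

theory Submission
  imports Defs
begin

text \<open>
  Both factorizations come from a pointwise identity \<open>G H = G\<^sub>-\<close> in which \<open>H\<close>, the prescribed
  inverse of \<open>G\<^sub>+\<close>, has constant determinant; Cramer's rule then keeps the inverses inside the
  algebras, and \<open>det G = 1\<close> gives \<open>G\<^sub>-\<close> the same determinant.  The entries of \<open>G\<^sub>-\<close> containing
  \<open>z - \<lambda>\<close> lie in the conjugate algebra because their other factor vanishes at infinity and thus
  absorbs \<open>z\<close>.  The analytic point is that \<open>(\<theta> - \<theta>(\<lambda>)) / (z - \<lambda>)\<close> is bounded for \<open>\<lambda>\<close> on the
  circle outside the spectrum: in the coordinate \<open>log (z / \<lambda>)\<close>, the function \<open>\<theta>\<close> and its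
  reflection \<open>1 / cnj \<theta>\<close> are bounded on the two sides of the imaginary axis and have the same
  boundary values, so \<open>\<theta>\<close> is Lipschitz near \<open>\<lambda>\<close>.
\<close>

section \<open>Bounded analytic functions and their boundary values\<close>

text \<open>Where the columns of \<open>H\<close> and the case split come from. Columns 1 and 3 have
  the form \<open>(u * \<theta> + s, v * \<theta> + r, - u * (z - \<lambda>), - v * (z -
  \<lambda>))\<close> with constants u, v, s, r. In the lower rows of \<open>G H\<close> the terms
  with a bare \<theta> cancel, which leaves z - \<lambda> times
  \<open>s + v * cnj A\<^sub>+ + r * cnj A\<^sub>+ * cnj \<theta>\<close> and
  \<open>r + u * A\<^sub>- + s * A\<^sub>- * cnj \<theta>\<close>. Vanishing at infinity means
  \<open>s + a * v + a * t * r = 0\<close> and \<open>r + b * u + b * t * s = 0\<close>, a system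
  for s and r with determinant \<Delta>. If \<Delta> is nonzero, (u, v) = (1, 0) and (0, 1) give the
  two columns. If \<Delta> = 0, (u, v) can no longer be prescribed freely; the columns then use (u,
  v, s, r) = (a t, 1, -a, 0) and (0, 0, -a t, 1). The obstacle on the circle: an angular derivative
  controls the difference quotient only inside Stolz regions, whereas membership in the algebra
  needs a bound on the whole disc. The lower bound for the modulus of \<theta> near \<lambda>
  supplies it.\<close>

lemma measurable_cis_sphere:
  "cis \<in> measurable (lebesgue_on {0..<2*pi}) (restrict_space borel (sphere 0 1))"
proof -
  have "cis \<in> borel_measurable borel"
    by (intro borel_measurable_continuous_onI continuous_intros)
  then have "cis \<in> borel_measurable lebesgue"
    by (simp add: measurable_completion)
  then have "cis \<in> borel_measurable (lebesgue_on {0..<2*pi})"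
    by (rule measurable_restrict_space1)
  then show ?thesis
    by (intro measurable_restrict_space2) auto
qed

lemma space_arc_measure [simp]: "space arc_measure = sphere 0 1"
  by (simp add: arc_measure_def space_restrict_space)

lemma AE_arc_measure_sphere: "AE \<zeta> in arc_measure. cmod \<zeta> = 1"
  by (rule AE_I2) simp

text \<open>Exceptional sets are needed for all real angles, since an interval of angles around a
  given point may cross the cut at 0. The null set in one period is therefore repeated with period
  \<open>2 * pi\<close>, a countable union.\<close>

lemma AE_arc_measure_negligible:
  assumes "AE \<zeta> in arc_measure. P \<zeta>"
  obtains N where "negligible N" "\<And>x. x \<notin> N \<Longrightarrow> P (cis x)"
proof -
  have "AE x in lebesgue_on {0..<2*pi}. P (cis x)"
    using assms unfolding arc_measure_def AE_completion_iff
    by (rule AE_distrD[OF measurable_cis_sphere])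
  then have "AE x in lebesgue. x \<in> {0..<2*pi} \<longrightarrow> P (cis x)"
    by (subst (asm) AE_restrict_space_iff) auto
  then obtain N where N: "negligible N" "{x. \<not> (x \<in> {0..<2*pi} \<longrightarrow> P (cis x))} \<subseteq> N"
    unfolding eventually_ae_filter_negligible by auto
  define N' where "N' = (\<Union>k::int. (+) (2 * pi * of_int k) ` N)"
  show thesis
  proof
    show "negligible N'"
      unfolding N'_def using N(1) by (intro negligible_countable_Union) (auto intro: negligible_translation)
    fix x assume "x \<notin> N'"
    define k where "k = \<lfloor>x / (2*pi)\<rfloor>"
    have "x - 2 * pi * of_int k \<notin> N"
      using \<open>x \<notin> N'\<close> unfolding N'_def by force
    moreover have "x - 2 * pi * of_int k \<in> {0..<2*pi}"
    proof -
      have "of_int k \<le> x / (2*pi)" "x / (2*pi) < of_int k + 1"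
        unfolding k_def by linarith+
      then have "of_int k * (2*pi) \<le> x" "x < (of_int k + 1) * (2*pi)"
        by (simp_all add: pos_le_divide_eq pos_divide_less_eq)
      then show ?thesis by (simp add: algebra_simps)
    qed
    ultimately have "P (cis (x - 2 * pi * of_int k))"
      using N(2) by blast
    also have "cis (x - 2 * pi * of_int k) = cis x"
      by (simp add: cis_divide[symmetric] cis_multiple_2pi)
    finally show "P (cis x)" .
  qed
qed

text \<open>\<open>cis\<close> is injective on one period, so a point has at most one angle there.
  This is what makes quotients by z - \<lambda> meaningful almost everywhere when \<lambda> lies on
  the circle.\<close>

lemma AE_arc_measure_neq: "AE \<zeta> in arc_measure. \<zeta> \<noteq> c"
proof -
  have "{x. 0 \<le> x \<and> x < 2*pi \<and> cis x = c} \<subseteq> {Arg2pi c}"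
    using Arg2pi_unique[of 1] by (auto simp: cis_conv_exp)
  then have "finite {x. 0 \<le> x \<and> x < 2*pi \<and> cis x = c}"
    by (rule finite_subset) simp
  then have "negligible {x. 0 \<le> x \<and> x < 2*pi \<and> cis x = c}" by (rule negligible_finite)
  then have "AE x in lebesgue. x \<in> {0..<2*pi} \<longrightarrow> cis x \<noteq> c"
    unfolding eventually_ae_filter_negligible by auto
  then have "AE x in lebesgue_on {0..<2*pi}. cis x \<noteq> c"
    by (subst AE_restrict_space_iff) auto
  then have "AE \<zeta> in distr (lebesgue_on {0..<2 * pi}) (restrict_space borel (sphere 0 1)) cis. \<zeta> \<noteq> c"
    by (subst AE_distr_iff[OF measurable_cis_sphere])
       (auto simp: space_restrict_space sets_restrict_space intro!: image_eqI[where x="- {c}"])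
  then show ?thesis unfolding arc_measure_def by (rule AE_completion)
qed

text \<open>The two preimages differ inside a null set, all of whose subsets are measurable in the
  completion.\<close>

lemma borel_measurable_completion_AE:
  assumes f: "f \<in> borel_measurable (completion M)" and eq: "AE x in completion M. f x = g x"
  shows "g \<in> borel_measurable (completion M)"
proof (rule measurableI)
  fix A :: "'b set" assume A: "A \<in> sets borel"
  obtain N where N: "{x \<in> space (completion M). f x \<noteq> g x} \<subseteq> N" "N \<in> null_sets (completion M)"
    using eq unfolding eventually_ae_filter by auto
  have "g -` A \<inter> space (completion M) =
      (f -` A \<inter> space (completion M) - N) \<union> (g -` A \<inter> space (completion M) \<inter> N)"
    using N(1) by auto
  moreover have "g -` A \<inter> space (completion M) \<inter> N \<in> sets (completion M)"
    by (rule completion.complete[OF _ N(2)]) auto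
  moreover have "f -` A \<inter> space (completion M) - N \<in> sets (completion M)"
    using measurable_sets[OF f A] N(2) by auto
  ultimately show "g -` A \<inter> space (completion M) \<in> sets (completion M)"
    by (metis sets.Un)
qed simp

text \<open>The radius is \<open>exp (-e)\<close> rather than \<open>1 - e\<close>, so that in the
  logarithmic coordinate the path becomes a horizontal segment traversed at unit speed. It stays in
  the Stolz region of aperture 2 because its distance to \<zeta> equals its distance to the
  circle.\<close>

lemma nontangential_radial:
  assumes "cmod \<zeta> = 1"
  shows "filterlim (\<lambda>e. of_real (exp (-e)) * \<zeta>) (nontangential \<zeta>) (at_right 0)"
proof -
  have "filterlim (\<lambda>e. of_real (exp (-e)) * \<zeta>) (at \<zeta> within stolz_region \<zeta> 2) (at_right 0)"
    unfolding filterlim_at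
  proof
    have "((\<lambda>e. of_real (exp (-e)) * \<zeta>) \<longlongrightarrow> of_real (exp (- 0)) * \<zeta>) (at_right 0)"
      by (intro tendsto_intros)
    then show "((\<lambda>e. of_real (exp (-e)) * \<zeta>) \<longlongrightarrow> \<zeta>) (at_right 0)" by simp
    show "\<forall>\<^sub>F e in at_right 0. of_real (exp (-e)) * \<zeta> \<in> stolz_region \<zeta> 2 \<and> of_real (exp (-e)) * \<zeta> \<noteq> \<zeta>"
      unfolding eventually_at_right_field
    proof (intro exI conjI allI impI)
      fix e :: real assume e: "0 < e" "e < 1"
      have n: "cmod (of_real (exp (-e)) * \<zeta>) = exp (-e)" using assms by (simp add: norm_mult)
      have "of_real (exp (-e)) * \<zeta> - \<zeta> = - (of_real (1 - exp (-e)) * \<zeta>)"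
        by (simp add: algebra_simps)
      then have "cmod (of_real (exp (-e)) * \<zeta> - \<zeta>) = 1 - exp (-e)"
        using e assms by (simp add: norm_mult del: of_real_diff)
      then show "of_real (exp (-e)) * \<zeta> \<in> stolz_region \<zeta> 2" "of_real (exp (-e)) * \<zeta> \<noteq> \<zeta>"
        using n e by (auto simp: stolz_region_def)
    qed (rule zero_less_one)
  qed
  then show ?thesis
    unfolding nontangential_def
    by (rule filterlim_mono) (auto intro!: SUP_upper)
qed

section \<open>Bounded analytic extensions and the algebra they form\<close>

lemma analytic_extension_disc_ext: "f \<in> Hinf \<Longrightarrow> analytic_extension (disc_ext f) f"
  unfolding Hinf_def disc_ext_def mem_Collect_eq by (erule someI_ex)

lemma analytic_extensionE:
  assumes "analytic_extension F f"
  obtains B where "F holomorphic_on ball 0 1" "\<And>z. cmod z < 1 \<Longrightarrow> cmod (F z) \<le> B"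
    "AE \<zeta> in arc_measure. (F \<longlongrightarrow> f \<zeta>) (nontangential \<zeta>)"
proof -
  obtain B where "\<forall>w\<in>F ` ball 0 1. cmod w \<le> B"
    using assms unfolding analytic_extension_def bounded_iff by blast
  then have "cmod (F z) \<le> B" if "cmod z < 1" for z
    using that by simp
  with assms that show thesis unfolding analytic_extension_def by blast
qed

lemma analytic_extensionI:
  assumes "F holomorphic_on ball 0 1" "\<And>z. cmod z < 1 \<Longrightarrow> cmod (F z) \<le> B"
    "AE \<zeta> in arc_measure. (F \<longlongrightarrow> f \<zeta>) (nontangential \<zeta>)"
  shows "analytic_extension F f"
proof -
  have "bounded (F ` ball 0 1)" unfolding bounded_iff using assms(2) by (intro exI[of _ B]) auto
  with assms(1,3) show ?thesis by (simp add: analytic_extension_def)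
qed

lemma analytic_extension_cong_AE:
  assumes "analytic_extension F f" "AE \<zeta> in arc_measure. f \<zeta> = g \<zeta>"
  shows "analytic_extension F g"
proof -
  have "AE \<zeta> in arc_measure. (F \<longlongrightarrow> f \<zeta>) (nontangential \<zeta>)"
    using assms by (simp add: analytic_extension_def)
  then have "AE \<zeta> in arc_measure. (F \<longlongrightarrow> g \<zeta>) (nontangential \<zeta>)"
    using assms(2) by eventually_elim simp
  then show ?thesis using assms by (simp add: analytic_extension_def)
qed

lemma nontangential_ident: "((\<lambda>z. z) \<longlongrightarrow> \<zeta>) (nontangential \<zeta>)"
  unfolding tendsto_nontangential_iff by (auto intro: tendsto_ident_at)

lemma analytic_extension_const: "analytic_extension (\<lambda>_. c) (\<lambda>_. c)"
  by (auto simp: analytic_extension_def bounded_iff)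

lemma analytic_extension_ident: "analytic_extension (\<lambda>z. z) (\<lambda>z. z)"
  unfolding analytic_extension_def using nontangential_ident
  by (auto simp: bounded_iff intro!: exI[of _ 1] less_imp_le)

lemma analytic_extension_add:
  assumes "analytic_extension F f" "analytic_extension G g"
  shows "analytic_extension (\<lambda>z. F z + G z) (\<lambda>z. f z + g z)"
proof -
  obtain A where F1: "F holomorphic_on ball 0 1"
    and A: "\<And>z. cmod z < 1 \<Longrightarrow> cmod (F z) \<le> A"
    and F2: "AE \<zeta> in arc_measure. (F \<longlongrightarrow> f \<zeta>) (nontangential \<zeta>)"
    by (rule analytic_extensionE[OF assms(1)]) (rule that)
  obtain B where G1: "G holomorphic_on ball 0 1"
    and B: "\<And>z. cmod z < 1 \<Longrightarrow> cmod (G z) \<le> B"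
    and G2: "AE \<zeta> in arc_measure. (G \<longlongrightarrow> g \<zeta>) (nontangential \<zeta>)"
    by (rule analytic_extensionE[OF assms(2)]) (rule that)
  show ?thesis
  proof (rule analytic_extensionI)
    show "(\<lambda>z. F z + G z) holomorphic_on ball 0 1" using F1 G1 by (intro holomorphic_intros)
    show "cmod (F z + G z) \<le> A + B" if "cmod z < 1" for z
      using A[OF that] B[OF that] by (intro norm_triangle_mono)
    show "AE \<zeta> in arc_measure. ((\<lambda>z. F z + G z) \<longlongrightarrow> f \<zeta> + g \<zeta>) (nontangential \<zeta>)"
      using F2 G2 by eventually_elim (rule tendsto_add)
  qed
qed

lemma analytic_extension_mult:
  assumes "analytic_extension F f" "analytic_extension G g"
  shows "analytic_extension (\<lambda>z. F z * G z) (\<lambda>z. f z * g z)"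
proof -
  obtain A where F1: "F holomorphic_on ball 0 1"
    and A: "\<And>z. cmod z < 1 \<Longrightarrow> cmod (F z) \<le> A"
    and F2: "AE \<zeta> in arc_measure. (F \<longlongrightarrow> f \<zeta>) (nontangential \<zeta>)"
    by (rule analytic_extensionE[OF assms(1)]) (rule that)
  obtain B where G1: "G holomorphic_on ball 0 1"
    and B: "\<And>z. cmod z < 1 \<Longrightarrow> cmod (G z) \<le> B"
    and G2: "AE \<zeta> in arc_measure. (G \<longlongrightarrow> g \<zeta>) (nontangential \<zeta>)"
    by (rule analytic_extensionE[OF assms(2)]) (rule that)
  show ?thesis
  proof (rule analytic_extensionI)
    show "(\<lambda>z. F z * G z) holomorphic_on ball 0 1" using F1 G1 by (intro holomorphic_intros)
    show "cmod (F z * G z) \<le> A * B" if "cmod z < 1" for z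
      unfolding norm_mult using A[OF that] B[OF that]
      by (intro mult_mono) (auto intro: order_trans[OF norm_ge_zero])
    show "AE \<zeta> in arc_measure. ((\<lambda>z. F z * G z) \<longlongrightarrow> f \<zeta> * g \<zeta>) (nontangential \<zeta>)"
      using F2 G2 by eventually_elim (rule tendsto_mult)
  qed
qed

lemma analytic_extension_diff:
  assumes "analytic_extension F f" "analytic_extension G g"
  shows "analytic_extension (\<lambda>z. F z - G z) (\<lambda>z. f z - g z)"
  using analytic_extension_add[OF assms(1) analytic_extension_mult[OF analytic_extension_const[of "-1"] assms(2)]]
  by simp

lemma Hinf_cong_AE: "f \<in> Hinf \<Longrightarrow> AE \<zeta> in arc_measure. f \<zeta> = g \<zeta> \<Longrightarrow> g \<in> Hinf"
  unfolding Hinf_def using analytic_extension_cong_AE by blast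

lemma Hinf_const [intro]: "(\<lambda>_. c) \<in> Hinf"
  unfolding Hinf_def using analytic_extension_const by blast

lemma Hinf_ident [intro]: "(\<lambda>z. z) \<in> Hinf"
  unfolding Hinf_def using analytic_extension_ident by blast

lemma Hinf_add [intro]: "f \<in> Hinf \<Longrightarrow> g \<in> Hinf \<Longrightarrow> (\<lambda>z. f z + g z) \<in> Hinf"
  unfolding Hinf_def using analytic_extension_add by blast

lemma Hinf_mult [intro]: "f \<in> Hinf \<Longrightarrow> g \<in> Hinf \<Longrightarrow> (\<lambda>z. f z * g z) \<in> Hinf"
  unfolding Hinf_def using analytic_extension_mult by blast

text \<open>The boundary function is almost everywhere the limit of the dilates
  \<open>F (r n * \<zeta>)\<close>, which are continuous on the circle.\<close>

lemma Hinf_measurable: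
  assumes "f \<in> Hinf"
  shows "f \<in> borel_measurable arc_measure"
proof -
  obtain F where hol: "F holomorphic_on ball 0 1" and lim: "AE \<zeta> in arc_measure. (F \<longlongrightarrow> f \<zeta>) (nontangential \<zeta>)"
    using assms by (auto simp: Hinf_def analytic_extension_def)
  define r where "r n = exp (- inverse (real (Suc n)))" for n
  have "(\<lambda>n. inverse (real (Suc n))) \<longlonglongrightarrow> 0" by (rule LIMSEQ_inverse_real_of_nat)
  then have r: "filterlim (\<lambda>n. inverse (real (Suc n))) (at_right 0) sequentially"
    by (auto simp: filterlim_at)
  define g where "g n \<zeta> = F (of_real (r n) * \<zeta>)" for n \<zeta>
  have g: "g n \<in> borel_measurable arc_measure" for n
  proof -
    have "continuous_on (sphere 0 1) (g n)"
      unfolding g_def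
      by (rule continuous_on_compose2[OF holomorphic_on_imp_continuous_on[OF hol]])
        (auto intro!: continuous_intros simp: norm_mult r_def)
    then have "g n \<in> borel_measurable (restrict_space borel (sphere 0 1))"
      by (rule borel_measurable_continuous_on_restrict)
    then have "g n \<in> borel_measurable (distr (lebesgue_on {0..<2 * pi}) (restrict_space borel (sphere 0 1)) cis)"
      by simp
    then show ?thesis unfolding arc_measure_def by (rule measurable_completion)
  qed
  moreover have "AE \<zeta> in arc_measure. (\<lambda>n. g n \<zeta>) \<longlonglongrightarrow> f \<zeta>"
    using lim AE_arc_measure_sphere
  proof eventually_elim
    case (elim \<zeta>)
    show ?case unfolding g_def r_def
      using filterlim_compose[OF elim(1) filterlim_compose[OF nontangential_radial[OF elim(2)] r]] by simp
  qed
  \<comment> \<open>Where the dilates diverge, \<open>lim\<close> is a default value, but as a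
    function of \<zeta> it is measurable all the same and agrees with \<open>f\<close> off a null
    set.\<close>
  ultimately have "AE \<zeta> in arc_measure. lim (\<lambda>n. g n \<zeta>) = f \<zeta>"
    by (auto elim!: eventually_mono intro: limI)
  moreover have "(\<lambda>\<zeta>. lim (\<lambda>n. g n \<zeta>)) \<in> borel_measurable arc_measure"
    using g by (rule borel_measurable_lim_metric)
  ultimately show ?thesis
    unfolding arc_measure_def by (rule borel_measurable_completion_AE[rotated])
qed

lemma Hinf_bounded_AE:
  assumes "f \<in> Hinf"
  shows "\<exists>C. AE \<zeta> in arc_measure. cmod (f \<zeta>) \<le> C"
proof -
  obtain F where "analytic_extension F f" using assms by (auto simp: Hinf_def)
  then obtain C where "F holomorphic_on ball 0 1" and C: "\<And>z. cmod z < 1 \<Longrightarrow> cmod (F z) \<le> C"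
    and lim: "AE \<zeta> in arc_measure. (F \<longlongrightarrow> f \<zeta>) (nontangential \<zeta>)"
    by (rule analytic_extensionE) (rule that)
  have "AE \<zeta> in arc_measure. cmod (f \<zeta>) \<le> C"
    using lim AE_arc_measure_sphere
  proof eventually_elim
    case (elim \<zeta>)
    have "((\<lambda>e. F (of_real (exp (-e)) * \<zeta>)) \<longlongrightarrow> f \<zeta>) (at_right 0)"
      by (rule filterlim_compose[OF elim(1) nontangential_radial[OF elim(2)]])
    moreover have "\<forall>\<^sub>F e in at_right 0. cmod (F (of_real (exp (-e)) * \<zeta>)) \<le> C"
      unfolding eventually_at_right_field
      using elim(2) by (auto intro!: exI[of _ 1] C simp: norm_mult)
    ultimately show ?case
      by (intro tendsto_upperbound[OF tendsto_norm]) auto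
  qed
  then show ?thesis ..
qed

lemma Hinf_Linf: "f \<in> Hinf \<Longrightarrow> f \<in> Linf"
  using Hinf_measurable Hinf_bounded_AE by (auto simp: Linf_def)

lemma conj_Hinf_Linf: "f \<in> conj_Hinf \<Longrightarrow> f \<in> Linf"
proof -
  assume "f \<in> conj_Hinf"
  then have *: "(\<lambda>\<zeta>. cnj (f \<zeta>)) \<in> Linf" unfolding conj_Hinf_def by (auto intro: Hinf_Linf)
  have "(\<lambda>\<zeta>. cnj (cnj (f \<zeta>))) \<in> borel_measurable arc_measure"
  proof (rule borel_measurable_continuous_on[of cnj])
    show "(\<lambda>\<zeta>. cnj (f \<zeta>)) \<in> borel_measurable arc_measure"
      using * unfolding Linf_def by blast
  qed (intro continuous_intros)
  then have "f \<in> borel_measurable arc_measure" by simp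
  with * show ?thesis by (simp add: Linf_def)
qed

lemma Linf_mult: "f \<in> Linf \<Longrightarrow> g \<in> Linf \<Longrightarrow> (\<lambda>\<zeta>. f \<zeta> * g \<zeta>) \<in> Linf"
proof -
  assume "f \<in> Linf" "g \<in> Linf"
  then obtain A B where m: "f \<in> borel_measurable arc_measure" "g \<in> borel_measurable arc_measure"
    and A: "AE \<zeta> in arc_measure. cmod (f \<zeta>) \<le> A" and B: "AE \<zeta> in arc_measure. cmod (g \<zeta>) \<le> B"
    unfolding Linf_def by auto
  have "AE \<zeta> in arc_measure. cmod (f \<zeta> * g \<zeta>) \<le> A * B"
    using A B
  proof eventually_elim
    case (elim \<zeta>)
    then show ?case unfolding norm_mult
      by (intro mult_mono) (auto intro: order_trans[OF norm_ge_zero])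
  qed
  with m show ?thesis by (auto simp: Linf_def)
qed

text \<open>The singularity at \<open>c\<close> is removable. The extended quotient is bounded by
  compactness on a closed disc around \<open>c\<close>, and by \<open>2 * B / r\<close> outside
  it.\<close>

lemma Hinf_difference_quotient:
  assumes F: "analytic_extension F f" and c: "c \<in> ball 0 1"
  shows "(\<lambda>z. (f z - F c) / (z - c)) \<in> Hinf"
proof -
  obtain B where hol: "F holomorphic_on ball 0 1"
    and B: "\<And>z. cmod z < 1 \<Longrightarrow> cmod (F z) \<le> B"
    and lim: "AE \<zeta> in arc_measure. (F \<longlongrightarrow> f \<zeta>) (nontangential \<zeta>)"
    by (rule analytic_extensionE[OF F]) (rule that)
  define G where "G z = (if z = c then deriv (\<lambda>z. F z - F c) c else (F z - F c) / (z - c))" for z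
  have holG: "G holomorphic_on ball 0 1"
  proof (rule pole_theorem_open_0[of "\<lambda>z. F z - F c" "ball 0 1" c G])
    show "(\<lambda>z. F z - F c) holomorphic_on ball 0 1" by (intro holomorphic_intros hol)
  qed (auto simp: G_def)
  obtain r where r: "r > 0" "cball c r \<subseteq> ball 0 1"
    using c open_contains_cball open_ball by blast
  have "compact (G ` cball c r)"
    by (intro compact_continuous_image compact_cball continuous_on_subset[OF holomorphic_on_imp_continuous_on[OF holG] r(2)])
  then have "bounded (G ` cball c r)" by (rule compact_imp_bounded)
  then obtain A where "\<forall>w\<in>G ` cball c r. cmod w \<le> A"
    unfolding bounded_iff by blast
  then have A: "cmod (G z) \<le> A" if "z \<in> cball c r" for z
    using that by blast
  have bG: "cmod (G z) \<le> max A (2 * B / r)" if z: "cmod z < 1" for z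
  proof (cases "z \<in> cball c r")
    case True then show ?thesis using A by (simp add: le_max_iff_disj)
  next
    case False
    then have d: "r < cmod (z - c)" by (simp add: dist_norm norm_minus_commute)
    then have "z \<noteq> c" using r by auto
    then have "cmod (G z) = cmod (F z - F c) / cmod (z - c)" by (simp add: G_def norm_divide)
    also have "\<dots> \<le> (B + B) / r"
      using d r B[OF z] B[of c] c
      by (intro frac_le order_trans[OF norm_triangle_ineq4] add_mono) (auto intro: order_trans[OF norm_ge_zero])
    finally show ?thesis by simp
  qed
  have "AE \<zeta> in arc_measure. (G \<longlongrightarrow> (f \<zeta> - F c) / (\<zeta> - c)) (nontangential \<zeta>)"
    using lim AE_arc_measure_neq[of c]
  proof eventually_elim
    case (elim \<zeta>)
    have "((\<lambda>z. (F z - F c) / (z - c)) \<longlongrightarrow> (f \<zeta> - F c) / (\<zeta> - c)) (nontangential \<zeta>)"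
      using elim by (intro tendsto_intros nontangential_ident) auto
    moreover have "\<forall>\<^sub>F z in nontangential \<zeta>. (F z - F c) / (z - c) = G z"
      using tendsto_imp_eventually_ne[OF nontangential_ident elim(2)]
      by eventually_elim (simp add: G_def)
    ultimately show ?case by (rule Lim_transform_eventually)
  qed
  from analytic_extensionI[OF holG _ this] bG have "analytic_extension G (\<lambda>\<zeta>. (f \<zeta> - F c) / (\<zeta> - c))"
    by blast
  then show ?thesis unfolding Hinf_def by blast
qed

section \<open>Difference quotients at regular boundary points\<close>

lemma contour_integral_rectpath:
  assumes "continuous_on (path_image (rectpath p q)) f"
  shows "contour_integral (rectpath p q) f =
    contour_integral (linepath p (Complex (Re q) (Im p))) f +
    contour_integral (linepath (Complex (Re q) (Im p)) q) f +
    contour_integral (linepath q (Complex (Re p) (Im q))) f +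
    contour_integral (linepath (Complex (Re p) (Im q)) p) f"
proof -
  let ?r = "Complex (Re q) (Im p)" and ?s = "Complex (Re p) (Im q)"
  have im: "path_image (rectpath p q) = closed_segment p ?r \<union> closed_segment ?r q \<union>
      closed_segment q ?s \<union> closed_segment ?s p"
    by (simp add: rectpath_def Let_def path_image_join Un_assoc)
  have "f contour_integrable_on linepath p ?r" "f contour_integrable_on linepath ?r q"
    "f contour_integrable_on linepath q ?s" "f contour_integrable_on linepath ?s p"
    using assms unfolding im
    by (auto intro!: contour_integrable_continuous_linepath elim!: continuous_on_subset)
  then show ?thesis
    by (simp add: rectpath_def Let_def)
qed

text \<open>A Painleve-type argument: in the Cauchy formula for the left rectangle one may add the
  vanishing integral over the right rectangle, and the edges along the common side cancel in the
  limit.  Only the edges away from the common side remain, where the kernel is Lipschitz.\<close>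

lemma lipschitz_across_common_edge:
  fixes U L :: "complex \<Rightarrow> complex" and \<delta> B :: real
  assumes \<delta>: "\<delta> > 0" and B: "B \<ge> 0"
    and U: "U holomorphic_on box (Complex (-2*\<delta>) (-2*\<delta>)) (Complex 0 (2*\<delta>))"
    and L: "L holomorphic_on box (Complex 0 (-2*\<delta>)) (Complex (2*\<delta>) (2*\<delta>))"
    and UB: "\<And>w. w \<in> box (Complex (-2*\<delta>) (-2*\<delta>)) (Complex 0 (2*\<delta>)) \<Longrightarrow> cmod (U w) \<le> B"
    and LB: "\<And>w. w \<in> box (Complex 0 (-2*\<delta>)) (Complex (2*\<delta>) (2*\<delta>)) \<Longrightarrow> cmod (L w) \<le> B"
    and N: "negligible N"
    and lim: "\<And>y. y \<notin> N \<Longrightarrow> \<bar>y\<bar> \<le> \<delta> \<Longrightarrow> \<exists>l.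
        ((\<lambda>e. U (Complex (-e) y)) \<longlongrightarrow> l) (at_right 0) \<and> ((\<lambda>e. L (Complex e y)) \<longlongrightarrow> l) (at_right 0)"
    and z: "z \<in> box (Complex (-\<delta>/2) (-\<delta>/2)) (Complex 0 (\<delta>/2))"
    and z': "z' \<in> box (Complex (-\<delta>/2) (-\<delta>/2)) (Complex 0 (\<delta>/2))"
  shows "cmod (U z - U z') \<le> 32 * B / \<delta> * cmod (z - z')"
proof -
  \<comment> \<open>A difference of two Cauchy kernels: integrating \<open>U * k\<close> around the
    left rectangle gives \<open>2 * pi * \<i>\<close> times \<open>U z - U z'\<close>, and away from
    both points \<open>k\<close> is of the order of \<open>z - z'\<close>.\<close>
  define k where "k w = 1 / (w - z) - 1 / (w - z')" for w
  \<comment> \<open>Bound for the integrand on the outer edges: there both points are at distance at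
    least \<delta>/2, and \<open>k\<close> equals \<open>z - z'\<close> divided by the product of
    the two differences.\<close>
  define C where "C = B * (4 * cmod (z - z') / \<delta>^2)"
  have C0: "C \<ge> 0" using B by (simp add: C_def)
  define RU where "RU = box (Complex (-2*\<delta>) (-2*\<delta>)) (Complex 0 (2*\<delta>))"
  define RL where "RL = box (Complex 0 (-2*\<delta>)) (Complex (2*\<delta>) (2*\<delta>))"
  \<comment> \<open>Distance from the common edge to the nearer of the two points. Contours with
    \<open>e < m/2\<close> still enclose both points.\<close>
  define m where "m = min (- Re z) (- Re z')"
  have m: "0 < m" "m < \<delta>/2" and rez: "Re z \<le> - m" "Re z' \<le> - m"
    using z z' by (auto simp: m_def in_box_complex_iff)
  have zc: "- \<delta>/2 < Re z" "- \<delta>/2 < Im z" "Im z < \<delta>/2"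
    "- \<delta>/2 < Re z'" "- \<delta>/2 < Im z'" "Im z' < \<delta>/2"
    using z z' by (simp_all add: in_box_complex_iff)
  have kb: "cmod (k w) \<le> 4 * cmod (z - z') / \<delta>^2" if "\<bar>Re w\<bar> \<ge> \<delta> \<or> \<bar>Im w\<bar> \<ge> \<delta>" for w
  proof -
    have "\<delta>/2 \<le> cmod (w - z)" "\<delta>/2 \<le> cmod (w - z')"
      using that zc m rez abs_Re_le_cmod[of "w - z"] abs_Im_le_cmod[of "w - z"]
        abs_Re_le_cmod[of "w - z'"] abs_Im_le_cmod[of "w - z'"]
      unfolding minus_complex.simps by linarith+
    then have *: "(\<delta>/2) * (\<delta>/2) \<le> cmod (w - z) * cmod (w - z')" and "w \<noteq> z" "w \<noteq> z'"
      using \<delta> by (auto intro!: mult_mono simp del: times_divide_eq_left times_divide_eq_right)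
    then have "k w = (z - z') / ((w - z) * (w - z'))" by (simp add: k_def field_simps)
    then have "cmod (k w) = cmod (z - z') / (cmod (w - z) * cmod (w - z'))"
      by (simp add: norm_divide norm_mult)
    also have "\<dots> \<le> cmod (z - z') / ((\<delta>/2) * (\<delta>/2))"
      using * \<delta> by (intro divide_left_mono) (auto intro!: mult_pos_pos simp: \<open>w \<noteq> z\<close> \<open>w \<noteq> z'\<close>)
    finally show ?thesis by (simp add: power2_eq_square field_simps)
  qed
  \<comment> \<open>This bound degenerates near the common edge. It only dominates the integrand
    while the two points are fixed, so \<open>m\<close> does not enter the final constant.\<close>
  have km: "cmod (k w) \<le> 4 / m" and knz: "w \<noteq> z" "w \<noteq> z'" if "Re w > - m/2" for w
  proof -
    have d: "m/2 \<le> cmod (w - z)" "m/2 \<le> cmod (w - z')"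
      using that rez abs_Re_le_cmod[of "w - z"] abs_Re_le_cmod[of "w - z'"] by auto
    then show "w \<noteq> z" "w \<noteq> z'" using m by auto
    have "cmod (k w) \<le> 1 / cmod (w - z) + 1 / cmod (w - z')"
      unfolding k_def by (rule order_trans[OF norm_triangle_ineq4]) (simp add: norm_divide)
    also have "\<dots> \<le> 1 / (m/2) + 1 / (m/2)"
      using d m by (intro add_mono divide_left_mono mult_pos_pos) auto
    finally show "cmod (k w) \<le> 4 / m" by simp
  qed
  have kcont: "continuous_on S k" if "z \<notin> S" "z' \<notin> S" for S
    unfolding k_def using that by (intro continuous_intros) auto
  \<comment> \<open>Up to the factor \<open>\<i>\<close>, the joint contribution of the two edges
    next to the common side, which are traversed in opposite directions.\<close>
  define M where "M e = integral {-\<delta>..\<delta>} (\<lambda>y. U (Complex (-e) y) * k (Complex (-e) y)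
      - L (Complex e y) * k (Complex e y))" for e
  have Uc: "continuous_on RU U" and Lc: "continuous_on RL L"
    using U L holomorphic_on_imp_continuous_on by (auto simp: RU_def RL_def)
  have cC: "continuous_on {-\<delta>..\<delta>} (\<lambda>y. Complex c y)" for c
    unfolding Complex_eq by (intro continuous_intros)
  have cUk: "continuous_on (RU - {z,z'}) (\<lambda>w. U w * k w)"
    and cLk: "continuous_on (RL - {z,z'}) (\<lambda>w. L w * k w)"
    by (intro continuous_on_mult continuous_on_subset[OF Uc] continuous_on_subset[OF Lc] kcont; auto)+
  have mem: "Complex (- e) y \<in> RU - {z,z'}" "Complex e y \<in> RL - {z,z'}"
    if "y \<in> {-\<delta>..\<delta>}" "0 < e" "e < m/2" for e y
  proof -
    have "Complex (- e) y \<in> RU" "Complex e y \<in> RL"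
      using that \<delta> m unfolding RU_def RL_def in_box_complex_iff complex.sel atLeastAtMost_iff greaterThanLessThan_iff
      by (intro conjI; linarith)+
    then show "Complex (- e) y \<in> RU - {z,z'}" "Complex e y \<in> RL - {z,z'}"
      using that m knz[of "Complex (- e) y"] knz[of "Complex e y"] by simp_all
  qed
  have int: "(\<lambda>y. U (Complex (-e) y) * k (Complex (-e) y)) integrable_on {-\<delta>..\<delta>}"
    "(\<lambda>y. L (Complex e y) * k (Complex e y)) integrable_on {-\<delta>..\<delta>}" if "0 < e" "e < m/2" for e
    using mem[OF _ that]
    by (intro integrable_continuous_real continuous_on_compose2[OF cUk cC]
        continuous_on_compose2[OF cLk cC]; blast)+
  \<comment> \<open>The six outer edges have total length at most \<open>8 * \<delta>\<close>: two
    vertical ones of length \<open>2 * \<delta>\<close> and four horizontal ones of length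
    \<open>\<delta> - e\<close>.\<close>
  have main: "2 * pi * cmod (U z - U z') \<le> C * (8 * \<delta>) + cmod (M e)" if e: "0 < e" "e < m/2" for e
  proof -
    define p q where "p = Complex (-\<delta>) (-\<delta>)" and "q = Complex (-e) \<delta>"
    define p' q' where "p' = Complex e (-\<delta>)" and "q' = Complex \<delta> \<delta>"
    have zb: "z \<in> box p q" "z' \<in> box p q"
      using e m zc rez unfolding p_def q_def in_box_complex_iff complex.sel greaterThanLessThan_iff by (intro conjI; linarith)+
    have "cbox p q \<subseteq> RU"
      using \<delta> e unfolding p_def q_def RU_def subset_iff in_box_complex_iff in_cbox_complex_iff complex.sel greaterThanLessThan_iff atLeastAtMost_iff
      by (intro allI impI conjI; linarith)
    moreover have "path_image (rectpath p q) = cbox p q - box p q"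
      using \<delta> e m by (intro path_image_rectpath_cbox_minus_box) (auto simp: p_def q_def)
    ultimately have imU: "path_image (rectpath p q) \<subseteq> RU - {z, z'}"
      using zb by blast
    have "cbox p' q' \<subseteq> RL"
      using \<delta> e unfolding p'_def q'_def RL_def subset_iff in_box_complex_iff in_cbox_complex_iff complex.sel greaterThanLessThan_iff atLeastAtMost_iff
      by (intro allI impI conjI; linarith)
    moreover have "path_image (rectpath p' q') \<subseteq> cbox p' q'"
      using \<delta> e m by (intro path_image_rectpath_subset_cbox) (auto simp: p'_def q'_def)
    moreover have "RL \<subseteq> - {z, z'}"
      using m rez by (auto simp: RL_def in_box_complex_iff)
    ultimately have imL: "path_image (rectpath p' q') \<subseteq> RL" "path_image (rectpath p' q') \<subseteq> - {z, z'}"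
      by blast+
    have zR: "z \<in> RU" "z' \<in> RU"
      using \<delta> zc m rez unfolding RU_def in_box_complex_iff complex.sel greaterThanLessThan_iff by (intro conjI; linarith)+
    have h1: "((\<lambda>w. U w / (w - v)) has_contour_integral (2*pi * \<i> * winding_number (rectpath p q) v * U v)) (rectpath p q)"
      if "v \<in> {z, z'}" for v
    proof (rule Cauchy_integral_formula_convex_simple)
      show "convex RU" "U holomorphic_on RU" using U by (auto simp: RU_def)
      show "v \<in> interior RU" using that zR by (auto simp: RU_def interior_open open_box)
    qed (use imU that in auto)
    have "((\<lambda>w. U w / (w - z) - U w / (w - z')) has_contour_integral
        (2*pi * \<i> * winding_number (rectpath p q) z * U z - 2*pi * \<i> * winding_number (rectpath p q) z' * U z')) (rectpath p q)"
      by (intro has_contour_integral_diff h1) auto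
    then have "((\<lambda>w. U w * k w) has_contour_integral (2*pi * \<i> * (U z - U z'))) (rectpath p q)"
      using zb by (simp add: winding_number_rectpath k_def algebra_simps)
    then have IU: "contour_integral (rectpath p q) (\<lambda>w. U w * k w) = 2*pi * \<i> * (U z - U z')"
      by (rule contour_integral_unique)
    \<comment> \<open>Both poles of the kernel lie to the left of the common edge, so
      \<open>L * k\<close> is holomorphic on the whole right rectangle.\<close>
    have "((\<lambda>w. L w * k w) has_contour_integral 0) (rectpath p' q')"
    proof (rule Cauchy_theorem_convex_simple)
      show "convex RL" by (simp add: RL_def)
      have "w - z \<noteq> 0" "w - z' \<noteq> 0" if "w \<in> RL" for w
        using knz[of w] m that by (auto simp: RL_def in_box_complex_iff)
      then show "(\<lambda>w. L w * k w) holomorphic_on RL"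
        unfolding k_def by (intro holomorphic_intros L[folded RL_def])
    qed (use imL(1) in simp_all)
    then have IL: "contour_integral (rectpath p' q') (\<lambda>w. L w * k w) = 0"
      by (rule contour_integral_unique)
    have cU: "continuous_on (path_image (rectpath p q)) (\<lambda>w. U w * k w)"
      using imU by (intro continuous_on_mult continuous_on_subset[OF Uc] kcont) auto
    have cL: "continuous_on (path_image (rectpath p' q')) (\<lambda>w. L w * k w)"
      using imL by (intro continuous_on_mult continuous_on_subset[OF Lc] kcont) auto
    let ?r = "Complex (-e) (-\<delta>)" and ?s = "Complex (-\<delta>) \<delta>"
    let ?r' = "Complex \<delta> (-\<delta>)" and ?s' = "Complex e \<delta>"
    have pim: "path_image (rectpath p q) = closed_segment p ?r \<union> closed_segment ?r q \<union>
        closed_segment q ?s \<union> closed_segment ?s p"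
      by (simp add: rectpath_def Let_def path_image_join Un_assoc p_def q_def)
    have pim': "path_image (rectpath p' q') = closed_segment p' ?r' \<union> closed_segment ?r' q' \<union>
        closed_segment q' ?s' \<union> closed_segment ?s' p'"
      by (simp add: rectpath_def Let_def path_image_join Un_assoc p'_def q'_def)
    have bU: "cmod (contour_integral (linepath u v) (\<lambda>w. U w * k w)) \<le> C * norm (v - u)"
      if "closed_segment u v \<subseteq> path_image (rectpath p q)"
        "\<And>w. w \<in> closed_segment u v \<Longrightarrow> \<bar>Re w\<bar> \<ge> \<delta> \<or> \<bar>Im w\<bar> \<ge> \<delta>" for u v
    proof (rule contour_integral_bound_linepath)
      show "(\<lambda>w. U w * k w) contour_integrable_on linepath u v"
        using that(1) cU by (intro contour_integrable_continuous_linepath) (rule continuous_on_subset)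
      fix w assume "w \<in> closed_segment u v"
      moreover from this have "w \<in> RU" using that(1) imU by blast
      ultimately show "cmod (U w * k w) \<le> C"
        unfolding C_def norm_mult RU_def using B
        by (intro mult_mono UB kb that(2) norm_ge_zero)
    qed (rule C0)
    have bL: "cmod (contour_integral (linepath u v) (\<lambda>w. L w * k w)) \<le> C * norm (v - u)"
      if "closed_segment u v \<subseteq> path_image (rectpath p' q')"
        "\<And>w. w \<in> closed_segment u v \<Longrightarrow> \<bar>Re w\<bar> \<ge> \<delta> \<or> \<bar>Im w\<bar> \<ge> \<delta>" for u v
    proof (rule contour_integral_bound_linepath)
      show "(\<lambda>w. L w * k w) contour_integrable_on linepath u v"
        using that(1) cL by (intro contour_integrable_continuous_linepath) (rule continuous_on_subset)
      fix w assume "w \<in> closed_segment u v"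
      moreover from this have "w \<in> RL" using that(1) imL by blast
      ultimately show "cmod (L w * k w) \<le> C"
        unfolding C_def norm_mult RL_def using B
        by (intro mult_mono LB kb that(2) norm_ge_zero)
    qed (rule C0)
    have sub: "closed_segment p ?r \<subseteq> path_image (rectpath p q)"
        "closed_segment q ?s \<subseteq> path_image (rectpath p q)"
        "closed_segment ?s p \<subseteq> path_image (rectpath p q)"
        "closed_segment p' ?r' \<subseteq> path_image (rectpath p' q')"
        "closed_segment ?r' q' \<subseteq> path_image (rectpath p' q')"
        "closed_segment q' ?s' \<subseteq> path_image (rectpath p' q')"
      unfolding pim pim' by auto
    have eU: "2*pi * \<i> * (U z - U z') =
        contour_integral (linepath p ?r) (\<lambda>w. U w * k w) + contour_integral (linepath ?r q) (\<lambda>w. U w * k w)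
      + contour_integral (linepath q ?s) (\<lambda>w. U w * k w) + contour_integral (linepath ?s p) (\<lambda>w. U w * k w)"
      using contour_integral_rectpath[OF cU] unfolding IU by (simp add: p_def q_def)
    have eL: "0 =
        contour_integral (linepath p' ?r') (\<lambda>w. L w * k w) + contour_integral (linepath ?r' q') (\<lambda>w. L w * k w)
      + contour_integral (linepath q' ?s') (\<lambda>w. L w * k w) + contour_integral (linepath ?s' p') (\<lambda>w. L w * k w)"
      using contour_integral_rectpath[OF cL] unfolding IL by (simp add: p'_def q'_def)
    have "contour_integral (linepath ?s' p') (\<lambda>w. L w * k w) = - contour_integral (linepath p' ?s') (\<lambda>w. L w * k w)"
      by (rule contour_integral_reverse_linepath, rule continuous_on_subset[OF cL])
        (unfold pim', blast)
    also have "contour_integral (linepath p' ?s') (\<lambda>w. L w * k w) =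
        \<i> * integral {-\<delta>..\<delta>} (\<lambda>y. L (Complex e y) * k (Complex e y))"
      using \<delta> by (subst contour_integral_linepath_same_Re[of _ e _ "-\<delta>" \<delta>]) (auto simp: p'_def)
    finally have eL4: "contour_integral (linepath ?s' p') (\<lambda>w. L w * k w) =
        - (\<i> * integral {-\<delta>..\<delta>} (\<lambda>y. L (Complex e y) * k (Complex e y)))" .
    have eU2: "contour_integral (linepath ?r q) (\<lambda>w. U w * k w) =
        \<i> * integral {-\<delta>..\<delta>} (\<lambda>y. U (Complex (-e) y) * k (Complex (-e) y))"
      using \<delta> by (subst contour_integral_linepath_same_Re[of _ "-e" _ "-\<delta>" \<delta>]) (auto simp: q_def)

    have Meq: "\<i> * M e = contour_integral (linepath ?r q) (\<lambda>w. U w * k w) + contour_integral (linepath ?s' p') (\<lambda>w. L w * k w)"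
      unfolding eL4 eU2 M_def integral_diff[OF int[OF e]] by (simp add: algebra_simps)
    have "2*pi * \<i> * (U z - U z') =
        contour_integral (linepath p ?r) (\<lambda>w. U w * k w)
      + contour_integral (linepath q ?s) (\<lambda>w. U w * k w) + contour_integral (linepath ?s p) (\<lambda>w. U w * k w)
      + contour_integral (linepath p' ?r') (\<lambda>w. L w * k w) + contour_integral (linepath ?r' q') (\<lambda>w. L w * k w)
      + contour_integral (linepath q' ?s') (\<lambda>w. L w * k w) + \<i> * M e" (is "_ = ?a + ?b + ?c + ?d + ?f + ?g + _")
      unfolding Meq using eU eL by (simp add: algebra_simps)
    then have "cmod (2*pi * \<i> * (U z - U z')) \<le> cmod ?a + cmod ?b + cmod ?c + cmod ?d + cmod ?f + cmod ?g + cmod (\<i> * M e)"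
      by (simp only:) (intro norm_triangle_mono order_refl)
    also have "\<dots> \<le> C * norm (?r - p) + C * norm (?s - q) + C * norm (p - ?s)
       + C * norm (?r' - p') + C * norm (q' - ?r') + C * norm (?s' - q') + cmod (\<i> * M e)"
      using \<delta> by (intro add_mono bU bL order_refl sub)
         (auto simp: p_def q_def p'_def q'_def closed_segment_same_Im closed_segment_same_Re)
    also have "\<dots> = C * (norm (?r - p) + norm (?s - q) + norm (p - ?s)
       + norm (?r' - p') + norm (q' - ?r') + norm (?s' - q')) + cmod (M e)"
      by (simp add: algebra_simps norm_mult)
    also have "\<dots> \<le> C * (8 * \<delta>) + cmod (M e)"
      using real_sqrt_unique[of "2 * \<delta>" "4 * \<delta>^2"] \<delta> e m C0
      by (intro add_mono mult_left_mono order_refl)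
        (auto simp: p_def q_def p'_def q'_def complex_diff cmod_def power_mult_distrib)
    finally show ?thesis by (simp add: norm_mult)
  qed
  define en where "en n = m / 3 * inverse (real (Suc n))" for n
  have en: "0 < en n" "en n < m/2" for n
  proof -
    have "en n \<le> m / 3 * 1"
      unfolding en_def using m by (intro mult_left_mono) (auto simp: field_simps)
    then show "0 < en n" "en n < m/2" using m by (auto simp: en_def)
  qed
  have "en \<longlonglongrightarrow> 0"
    unfolding en_def using tendsto_mult_right_zero[OF LIMSEQ_inverse_real_of_nat] by simp
  then have en0: "filterlim en (at_right 0) sequentially"
    using en(1) by (simp add: filterlim_at less_imp_neq[THEN not_sym])
  \<comment> \<open>Setting the integrand to 0 on \<open>N\<close> leaves its integral unchanged and
    makes it converge to 0 at every point of the interval.\<close>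
  define h where "h n y = (if y \<in> N then 0 else U (Complex (- en n) y) * k (Complex (- en n) y)
      - L (Complex (en n) y) * k (Complex (en n) y))" for n y
  have hM: "M (en n) = integral {-\<delta>..\<delta>} (h n)" for n
    unfolding M_def by (rule integral_spike[OF N]) (auto simp: h_def)
  have hint: "h n integrable_on {-\<delta>..\<delta>}" for n
  proof (rule integrable_spike[OF _ N])
    show "(\<lambda>y. U (Complex (- en n) y) * k (Complex (- en n) y)
      - L (Complex (en n) y) * k (Complex (en n) y)) integrable_on {-\<delta>..\<delta>}"
      using en by (intro integrable_diff int) auto
  qed (auto simp: h_def)
  have hb: "norm (h n y) \<le> B * (4/m) + B * (4/m)" if "y \<in> {-\<delta>..\<delta>}" for n y
  proof -
    have "Complex (- en n) y \<in> RU" "Complex (en n) y \<in> RL"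
      using mem[OF that en] by auto
    then have "norm (U (Complex (- en n) y) * k (Complex (- en n) y)) \<le> B * (4/m)"
      "norm (L (Complex (en n) y) * k (Complex (en n) y)) \<le> B * (4/m)"
      unfolding RU_def RL_def norm_mult using en[of n] m B
      by (intro mult_mono UB LB km; simp)+
    then have "norm (U (Complex (- en n) y) * k (Complex (- en n) y)
      - L (Complex (en n) y) * k (Complex (en n) y)) \<le> B * (4/m) + B * (4/m)"
      by (intro order_trans[OF norm_triangle_ineq4] add_mono)
    then show ?thesis using B m by (auto simp: h_def)
  qed
  have hl: "(\<lambda>n. h n y) \<longlonglongrightarrow> 0" if y: "y \<in> {-\<delta>..\<delta>}" for y
  proof (cases "y \<in> N")
    case True then show ?thesis by (simp add: h_def)
  next
    case False
    obtain l where l: "((\<lambda>e. U (Complex (-e) y)) \<longlongrightarrow> l) (at_right 0)" "((\<lambda>e. L (Complex e y)) \<longlongrightarrow> l) (at_right 0)"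
      using lim[OF False] y by (auto simp: abs_le_iff)
    have enl: "en \<longlonglongrightarrow> 0" using en0 by (simp add: filterlim_at)
    have kl: "isCont k (Complex 0 y)"
      using knz[of "Complex 0 y"] m unfolding k_def by (intro continuous_intros) auto
    have "(\<lambda>n. Complex (- en n) y) \<longlonglongrightarrow> Complex 0 y" "(\<lambda>n. Complex (en n) y) \<longlonglongrightarrow> Complex 0 y"
      using tendsto_minus[OF enl] enl by (auto intro: tendsto_Complex)
    then have "(\<lambda>n. k (Complex (- en n) y)) \<longlonglongrightarrow> k (Complex 0 y)" "(\<lambda>n. k (Complex (en n) y)) \<longlonglongrightarrow> k (Complex 0 y)"
      by (auto intro: isCont_tendsto_compose[OF kl])
    moreover have "(\<lambda>n. U (Complex (- en n) y)) \<longlonglongrightarrow> l" "(\<lambda>n. L (Complex (en n) y)) \<longlonglongrightarrow> l"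
      using filterlim_compose[OF l(1) en0] filterlim_compose[OF l(2) en0] by auto
    ultimately have "(\<lambda>n. U (Complex (- en n) y) * k (Complex (- en n) y)
      - L (Complex (en n) y) * k (Complex (en n) y)) \<longlonglongrightarrow> l * k (Complex 0 y) - l * k (Complex 0 y)"
      by (intro tendsto_intros)
    then show ?thesis using False by (simp add: h_def)
  qed
  have "(\<lambda>n. integral {-\<delta>..\<delta>} (h n)) \<longlonglongrightarrow> integral {-\<delta>..\<delta>} (\<lambda>_. 0::complex)"
    by (rule dominated_convergence(2)[OF hint _ hb hl]) auto
  then have "(\<lambda>n. C * (8 * \<delta>) + cmod (M (en n))) \<longlonglongrightarrow> C * (8 * \<delta>) + cmod 0"
    unfolding hM by (intro tendsto_intros) simp
  then have "2 * pi * cmod (U z - U z') \<le> C * (8 * \<delta>)"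
    by (intro tendsto_lowerbound[where F=sequentially]) (use main en in \<open>auto intro!: always_eventually\<close>)
  \<comment> \<open>The factor \<open>2 * pi\<close> is simply discarded; the 32 is 4 from
    \<open>C\<close> times 8 from the length of the edges.\<close>
  moreover have "1 * cmod (U z - U z') \<le> 2 * pi * cmod (U z - U z')"
    using pi_gt3 by (intro mult_right_mono) auto
  ultimately have "cmod (U z - U z') \<le> C * (8 * \<delta>)" by linarith
  also have "\<dots> = 32 * B / \<delta> * cmod (z - z')"
    using \<delta> by (simp add: C_def power2_eq_square field_simps)
  finally show ?thesis .
qed

section \<open>Inner functions near a point off the boundary spectrum\<close>

lemma nontangential_le: "nontangential \<zeta> \<le> at \<zeta> within ball 0 1"
  unfolding nontangential_def by (intro SUP_least at_le) (auto simp: stolz_region_def)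

text \<open>The lower bound \<open>c\<close> makes the reflected function holomorphic and bounded by
  \<open>1 / c\<close>. Since \<open>1 / cnj v = v\<close> for unimodular \<open>v\<close>, the
  function and its reflection have the same limit along almost every radius, which is what
  \<open>lipschitz_across_common_edge\<close> asks for.\<close>

lemma lipschitz_at_regular_boundary_point:
  assumes F: "analytic_extension F f" and f: "unimodular f" and lam: "cmod lam = 1"
    and c: "c > 0" and r: "r > 0"
    and lower: "\<And>z. cmod z < 1 \<Longrightarrow> cmod (z - lam) < r \<Longrightarrow> c \<le> cmod (F z)"
  obtains K d where "d > 0" "\<And>z z'. cmod z < 1 \<Longrightarrow> cmod (z - lam) < d \<Longrightarrow> cmod z' < 1 \<Longrightarrow>
    cmod (z' - lam) < d \<Longrightarrow> cmod (F z - F z') \<le> K * cmod (z - z')"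
proof -
  obtain B where hol: "F holomorphic_on ball 0 1"
    and B: "\<And>z. cmod z < 1 \<Longrightarrow> cmod (F z) \<le> B"
    and lim: "AE \<zeta> in arc_measure. (F \<longlongrightarrow> f \<zeta>) (nontangential \<zeta>)"
    by (rule analytic_extensionE[OF F]) (rule that)
  \<comment> \<open>Horizontal lines correspond to radii, and reflection in the circle corresponds
    to the map taking \<open>w\<close> to \<open>- cnj w\<close>.\<close>
  define E where "E w = lam * exp w" for w
  have nE: "cmod (E w) = exp (Re w)" for w
    using lam by (simp add: E_def norm_mult)
  have holE: "E holomorphic_on S" for S
    unfolding E_def by (intro holomorphic_intros)
  have "isCont E 0" unfolding E_def by (intro continuous_intros)
  then obtain \<delta>0 where \<delta>0: "\<delta>0 > 0" and near: "\<And>w. cmod w < \<delta>0 \<Longrightarrow> cmod (E w - lam) < r"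
    using r unfolding continuous_at_eps_delta by (auto simp: E_def dist_norm)
  \<comment> \<open>Real and imaginary parts in the rectangle \<open>RU\<close> are below
    \<open>2 * \<delta>\<close> in modulus, hence \<open>cmod w < 4 * \<delta>\<close>, which is
    \<delta>0.\<close>
  define \<delta> where "\<delta> = \<delta>0 / 4"
  have \<delta>: "\<delta> > 0" using \<delta>0 by (simp add: \<delta>_def)
  define RU where "RU = box (Complex (-2*\<delta>) (-2*\<delta>)) (Complex 0 (2*\<delta>))"
  define RL where "RL = box (Complex 0 (-2*\<delta>)) (Complex (2*\<delta>) (2*\<delta>))"
  have RU: "cmod (E w) < 1" "c \<le> cmod (F (E w))" if "w \<in> RU" for w
  proof -
    have w: "- 2 * \<delta> < Re w" "Re w < 0" "- 2 * \<delta> < Im w" "Im w < 2 * \<delta>"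
      using that by (auto simp: RU_def in_box_complex_iff)
    then show "cmod (E w) < 1" by (simp add: nE)
    have "cmod w < \<delta>0" using cmod_le[of w] w by (simp add: \<delta>_def)
    then show "c \<le> cmod (F (E w))"
      using lower near \<open>cmod (E w) < 1\<close> by blast
  qed
  have refl: "- cnj w \<in> RU" if "w \<in> RL" for w
    using that by (auto simp: RU_def RL_def in_box_complex_iff)
  define U where "U w = F (E w)" for w
  define L where "L w = inverse (cnj (F (E (- cnj w))))" for w
  have "U holomorphic_on RU"
    unfolding U_def using RU(1)
    by (intro holomorphic_on_compose_gen[OF holE hol, unfolded o_def]) auto
  have "L holomorphic_on RL"
  proof -
    \<comment> \<open>Conjugating both argument and value preserves holomorphy, so the unconjugated
      map is examined on the mirror image of \<open>RL\<close>.\<close>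
    have "(\<lambda>v. F (E (- v))) holomorphic_on cnj ` RL"
    proof (rule holomorphic_on_compose_gen[OF _ hol, unfolded o_def])
      show "(\<lambda>v. E (- v)) holomorphic_on cnj ` RL"
        unfolding E_def by (intro holomorphic_intros)
      show "(\<lambda>v. E (- v)) ` cnj ` RL \<subseteq> ball 0 1"
        using RU(1) refl by auto
    qed
    then have "(cnj \<circ> (\<lambda>v. F (E (- v))) \<circ> cnj) holomorphic_on RL"
      by (rule holomorphic_on_compose_cnj_cnj) (simp add: RL_def open_box)
    then have "(\<lambda>w. cnj (F (E (- cnj w)))) holomorphic_on RL"
      by (simp add: o_def)
    then show ?thesis
      unfolding L_def using RU(2)[OF refl] c by (intro holomorphic_on_inverse) force+
  qed
  define B' where "B' = max B (inverse c)"
  have B': "0 \<le> B'" using c by (simp add: B'_def le_max_iff_disj)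
  have UB: "cmod (U w) \<le> B'" if "w \<in> RU" for w
    using B[OF RU(1)[OF that]] by (simp add: B'_def U_def le_max_iff_disj)
  have LB: "cmod (L w) \<le> B'" if "w \<in> RL" for w
    using le_imp_inverse_le[OF RU(2)[OF refl[OF that]] c]
    by (simp add: B'_def L_def le_max_iff_disj norm_inverse)
  have "AE \<zeta> in arc_measure. (F \<longlongrightarrow> f \<zeta>) (nontangential \<zeta>) \<and> cmod (f \<zeta>) = 1"
    using lim f unfolding unimodular_def by eventually_elim simp
  then obtain N where N: "negligible N"
    "\<And>x. x \<notin> N \<Longrightarrow> (F \<longlongrightarrow> f (cis x)) (nontangential (cis x)) \<and> cmod (f (cis x)) = 1"
    by (rule AE_arc_measure_negligible) (rule that)
  define s where "s = Arg2pi lam"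
  have s: "lam = cis s"
    using Arg2pi_eq[of lam] lam by (simp add: s_def cis_conv_exp)
  \<comment> \<open>Height \<open>y\<close> in the new coordinate corresponds to the angle
    \<open>s + y\<close> on the circle.\<close>
  define N' where "N' = (+) (- s) ` N"
  have negl: "negligible N'"
    unfolding N'_def using N(1) by (rule negligible_translation)
  have bdry: "\<exists>l. ((\<lambda>e. U (Complex (-e) y)) \<longlongrightarrow> l) (at_right 0) \<and> ((\<lambda>e. L (Complex e y)) \<longlongrightarrow> l) (at_right 0)"
    if "y \<notin> N'" for y
  proof -
    have "s + y \<notin> N" using that unfolding N'_def by force
    then have lim: "(F \<longlongrightarrow> f (cis (s + y))) (nontangential (cis (s + y)))" and 1: "cmod (f (cis (s + y))) = 1"
      using N(2) by auto
    have e: "E (Complex (-e) y) = of_real (exp (-e)) * cis (s + y)" for e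
      by (simp add: E_def s exp_eq_polar cis_mult mult_ac)
    have *: "((\<lambda>e. F (E (Complex (-e) y))) \<longlongrightarrow> f (cis (s + y))) (at_right 0)"
      unfolding e by (rule filterlim_compose[OF lim nontangential_radial]) simp
    have "((\<lambda>e. inverse (cnj (F (E (Complex (-e) y))))) \<longlongrightarrow> inverse (cnj (f (cis (s + y))))) (at_right 0)"
      using 1 by (intro tendsto_intros *) auto
    moreover have "inverse (cnj (f (cis (s + y)))) = f (cis (s + y))"
      using 1 complex_norm_square[of "f (cis (s + y))"]
      by (intro inverse_unique) (simp add: mult.commute)
    moreover have "- cnj (Complex e y) = Complex (-e) y" for e
      by (simp add: complex_eq_iff)
    ultimately show ?thesis using * unfolding U_def L_def by auto
  qed
  have Ulip: "cmod (U w - U w') \<le> 32 * B' / \<delta> * cmod (w - w')"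
    if "w \<in> box (Complex (-\<delta>/2) (-\<delta>/2)) (Complex 0 (\<delta>/2))"
      "w' \<in> box (Complex (-\<delta>/2) (-\<delta>/2)) (Complex 0 (\<delta>/2))" for w w'
    using that \<open>U holomorphic_on RU\<close> \<open>L holomorphic_on RL\<close> UB LB bdry negl \<delta> B'
    unfolding RU_def RL_def by (intro lipschitz_across_common_edge[where N=N' and L=L]) auto
  \<comment> \<open>On this disc the derivative \<open>inverse x\<close> of the logarithm is at most
    2 in modulus. Passing back to the disc thus turns the constant 32 into 64.\<close>
  have Lnlip: "cmod (Ln u - Ln v) \<le> 2 * cmod (u - v)" if "u \<in> ball 1 (1/2)" "v \<in> ball 1 (1/2)" for u v
  proof (rule field_differentiable_bound[where f'=inverse and S="ball 1 (1/2)"])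
    fix x :: complex assume x: "x \<in> ball 1 (1/2)"
    have re: "1/2 < Re x"
      using x abs_Re_le_cmod[of "1 - x"] by (auto simp: dist_norm)
    show "(Ln has_field_derivative inverse x) (at x within ball 1 (1/2))"
      using re by (auto intro!: has_field_derivative_at_within[OF has_field_derivative_Ln] simp: complex_nonpos_Reals_iff)
    have "1/2 \<le> cmod x" using re complex_Re_le_cmod[of x] by linarith
    then show "cmod (inverse x) \<le> 2"
      using le_imp_inverse_le[of "1/2" "cmod x"] by (simp add: norm_inverse)
  qed (use that in auto)
  \<comment> \<open>The 1/2 keeps \<open>z / lam\<close> where the logarithm is 2-Lipschitz; the
    \<delta>/4 then places the logarithm within \<delta>/2 of 0, in the box where
    \<open>Ulip\<close> holds.\<close>
  define d where "d = min (1/2) (\<delta>/4)"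
  show thesis
  proof (rule that)
    show "0 < d" using \<delta> by (simp add: d_def)
    have pull: "\<exists>w. w = Ln (z / lam) \<and> z / lam \<in> ball 1 (1/2) \<and>
        w \<in> box (Complex (-\<delta>/2) (-\<delta>/2)) (Complex 0 (\<delta>/2)) \<and> E w = z"
      if z: "cmod z < 1" "cmod (z - lam) < d" for z
    proof -
      have lam0: "lam \<noteq> 0" using lam by auto
      have "cmod (z / lam - 1) = cmod ((z - lam) / lam)" using lam0 by (simp add: field_simps)
      then have u: "cmod (z / lam - 1) = cmod (z - lam)" using lam by (simp add: norm_divide)
      then have ub: "z / lam \<in> ball 1 (1/2)"
        using z by (simp add: dist_norm norm_minus_commute d_def)
      then have "cmod (Ln (z / lam)) \<le> 2 * cmod (z / lam - 1)"
        using Lnlip[of "z / lam" 1] by simp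
      then have small: "cmod (Ln (z / lam)) < \<delta> / 2"
        using z u by (simp add: d_def)
      have "z \<noteq> 0" using z lam by (auto simp: d_def)
      then have ex: "exp (Ln (z / lam)) = z / lam" using lam0 by simp
      then have "exp (Re (Ln (z / lam))) = cmod z"
        using lam norm_exp_eq_Re[of "Ln (z / lam)"] by (simp add: norm_divide)
      then have "Re (Ln (z / lam)) < 0" using z by (metis exp_less_one_iff)
      then have "Ln (z / lam) \<in> box (Complex (-\<delta>/2) (-\<delta>/2)) (Complex 0 (\<delta>/2))"
        using small abs_Re_le_cmod[of "Ln (z / lam)"] abs_Im_le_cmod[of "Ln (z / lam)"]
        by (auto simp: in_box_complex_iff)
      then show ?thesis using ub ex lam0 by (simp add: E_def)
    qed
    fix z z' assume z: "cmod z < 1" "cmod (z - lam) < d" and z': "cmod z' < 1" "cmod (z' - lam) < d"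
    have "cmod (F z - F z') \<le> 32 * B' / \<delta> * cmod (Ln (z / lam) - Ln (z' / lam))"
      using Ulip[of "Ln (z / lam)" "Ln (z' / lam)"] pull[OF z] pull[OF z'] by (simp add: U_def)
    also have "\<dots> \<le> 32 * B' / \<delta> * (2 * cmod (z / lam - z' / lam))"
      using Lnlip[of "z / lam" "z' / lam"] pull[OF z] pull[OF z'] \<delta> B'
      by (intro mult_left_mono) auto
    also have "cmod (z / lam - z' / lam) = cmod (z - z')"
      using lam by (simp add: diff_divide_distrib[symmetric] norm_divide)
    finally show "cmod (F z - F z') \<le> (64 * B' / \<delta>) * cmod (z - z')" by simp
  qed
qed

text \<open>The Lipschitz estimate concerns two points of the disc. Letting one of them tend to
  \<open>lam\<close> nontangentially bounds the quotient by \<open>K\<close> near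
  \<open>lam\<close>; farther away it is at most \<open>2 * B / d\<close>.\<close>

lemma Hinf_boundary_quotient:
  assumes F: "analytic_extension F f" and f: "unimodular f" and lam: "cmod lam = 1"
    and w: "(F \<longlongrightarrow> w) (nontangential lam)"
    and c: "c > 0" and r: "r > 0"
    and lower: "\<And>z. cmod z < 1 \<Longrightarrow> cmod (z - lam) < r \<Longrightarrow> c \<le> cmod (F z)"
  shows "(\<lambda>z. (f z - w) / (z - lam)) \<in> Hinf"
proof -
  obtain B where hol: "F holomorphic_on ball 0 1"
    and B: "\<And>z. cmod z < 1 \<Longrightarrow> cmod (F z) \<le> B"
    and lim: "AE \<zeta> in arc_measure. (F \<longlongrightarrow> f \<zeta>) (nontangential \<zeta>)"
    by (rule analytic_extensionE[OF F]) (rule that)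
  obtain K d where d: "d > 0" and lip: "\<And>z z'. cmod z < 1 \<Longrightarrow> cmod (z - lam) < d \<Longrightarrow> cmod z' < 1 \<Longrightarrow>
    cmod (z' - lam) < d \<Longrightarrow> cmod (F z - F z') \<le> K * cmod (z - z')"
    by (rule lipschitz_at_regular_boundary_point[OF F f lam c r]) (erule (1) lower, rule that)
  have B0: "0 \<le> B" using B[of 0] norm_ge_zero[of "F 0"] by (simp del: norm_ge_zero)
  have nb: "\<forall>\<^sub>F z in nontangential lam. cmod z < 1 \<and> cmod (z - lam) < d"
    using d by (intro filter_leD[OF nontangential_le])
      (auto simp: eventually_at dist_norm intro!: exI[of _ d])
  have wB: "cmod w \<le> B"
    by (rule tendsto_upperbound[OF tendsto_norm[OF w] _ nontangential_neq_bot[OF lam]])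
      (use nb B in \<open>auto elim: eventually_mono\<close>)
  define G where "G z = (F z - w) / (z - lam)" for z
  have holG: "G holomorphic_on ball 0 1"
    unfolding G_def using lam by (intro holomorphic_intros hol) auto
  have bG: "cmod (G z) \<le> max K (2 * B / d)" if z: "cmod z < 1" for z
  proof (cases "cmod (z - lam) < d")
    case True
    have "cmod (F z - w) \<le> K * cmod (z - lam)"
    proof (rule tendsto_le[OF nontangential_neq_bot[OF lam]])
      show "((\<lambda>z'. cmod (F z - F z')) \<longlongrightarrow> cmod (F z - w)) (nontangential lam)"
        by (intro tendsto_intros w)
      show "((\<lambda>z'. K * cmod (z - z')) \<longlongrightarrow> K * cmod (z - lam)) (nontangential lam)"
        by (intro tendsto_intros nontangential_ident)
      show "\<forall>\<^sub>F z' in nontangential lam. cmod (F z - F z') \<le> K * cmod (z - z')"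
        using nb by eventually_elim (use z True lip in auto)
    qed
    moreover have "cmod (z - lam) > 0" using z lam by auto
    ultimately have "cmod (G z) \<le> K" by (simp add: G_def norm_divide pos_divide_le_eq)
    then show ?thesis by simp
  next
    case False
    then have "cmod (G z) \<le> (B + B) / d"
      unfolding G_def norm_divide using d B[OF z] wB B0
      by (intro frac_le order_trans[OF norm_triangle_ineq4] add_mono) auto
    then show ?thesis by simp
  qed
  have "AE \<zeta> in arc_measure. (G \<longlongrightarrow> (f \<zeta> - w) / (\<zeta> - lam)) (nontangential \<zeta>)"
    using lim AE_arc_measure_neq[of lam]
  proof eventually_elim
    case (elim \<zeta>)
    then show ?case unfolding G_def by (intro tendsto_intros nontangential_ident) auto
  qed
  from analytic_extensionI[OF holG _ this] bG have "analytic_extension G (\<lambda>\<zeta>. (f \<zeta> - w) / (\<zeta> - lam))"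
    by blast
  then show ?thesis unfolding Hinf_def by blast
qed

text \<open>A lower limit of moduli that is not 0 is positive. The constant is a real number
  strictly between 0 and it, chosen by density so that an infinite value needs no separate
  treatment.\<close>

lemma not_boundary_spectrumE:
  assumes "lam \<in> sphere 0 1" "lam \<notin> boundary_spectrum \<theta>"
  obtains c r where "c > 0" "r > 0"
    "\<And>z. cmod z < 1 \<Longrightarrow> cmod (z - lam) < r \<Longrightarrow> c \<le> cmod (disc_ext \<theta> z)"
proof -
  let ?l = "Liminf (at lam within ball 0 1) (\<lambda>z. ereal (cmod (disc_ext \<theta> z)))"
  have "0 \<le> ?l" by (rule Liminf_bounded) simp
  then have "0 < ?l" using assms by (simp add: boundary_spectrum_def order.strict_iff_order)
  then obtain y where y: "0 < ereal y" "ereal y < ?l" using ereal_dense2 by blast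
  then have "\<forall>\<^sub>F z in at lam within ball 0 1. ereal y < ereal (cmod (disc_ext \<theta> z))"
    by (intro less_LiminfD)
  then obtain d where "d > 0" "\<And>z. z \<in> ball 0 1 \<Longrightarrow> z \<noteq> lam \<Longrightarrow> dist z lam < d \<Longrightarrow> y < cmod (disc_ext \<theta> z)"
    unfolding eventually_at by auto
  moreover have "z \<noteq> lam" if "cmod z < 1" for z using that assms(1) by auto
  ultimately show thesis using y(1)
    by (intro that[of y d]) (simp_all add: dist_norm less_imp_le)
qed

section \<open>Matrices over function algebras\<close>

text \<open>Common interface of \<open>Hinf\<close> and \<open>conj_Hinf\<close>, so that
  determinants and inverses are treated once for both. Closure under almost everywhere equality is
  included because the matrix identities hold only off null sets.\<close>

definition AE_function_ring :: "(complex \<Rightarrow> complex) set \<Rightarrow> bool" where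
  "AE_function_ring S \<longleftrightarrow> (\<forall>c. (\<lambda>_. c) \<in> S) \<and>
     (\<forall>f\<in>S. \<forall>g\<in>S. (\<lambda>\<zeta>. f \<zeta> + g \<zeta>) \<in> S \<and> (\<lambda>\<zeta>. f \<zeta> * g \<zeta>) \<in> S) \<and>
     (\<forall>f\<in>S. \<forall>g. (AE \<zeta> in arc_measure. f \<zeta> = g \<zeta>) \<longrightarrow> g \<in> S)"

lemma
  assumes "AE_function_ring S"
  shows AE_function_ring_const: "(\<lambda>_. c) \<in> S"
    and AE_function_ring_add: "f \<in> S \<Longrightarrow> g \<in> S \<Longrightarrow> (\<lambda>\<zeta>. f \<zeta> + g \<zeta>) \<in> S"
    and AE_function_ring_mult: "f \<in> S \<Longrightarrow> g \<in> S \<Longrightarrow> (\<lambda>\<zeta>. f \<zeta> * g \<zeta>) \<in> S"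
    and AE_function_ring_cong: "f \<in> S \<Longrightarrow> AE \<zeta> in arc_measure. f \<zeta> = g \<zeta> \<Longrightarrow> g \<in> S"
  using assms unfolding AE_function_ring_def by blast+

lemma AE_function_ring_minus: "AE_function_ring S \<Longrightarrow> f \<in> S \<Longrightarrow> (\<lambda>\<zeta>. - f \<zeta>) \<in> S"
  using AE_function_ring_mult[OF _ AE_function_ring_const[of S "-1"], of f] by simp

lemma AE_function_ring_diff:
  "AE_function_ring S \<Longrightarrow> f \<in> S \<Longrightarrow> g \<in> S \<Longrightarrow> (\<lambda>\<zeta>. f \<zeta> - g \<zeta>) \<in> S"
  using AE_function_ring_add[OF _ _ AE_function_ring_minus, of S f g] by simp

lemma AE_function_ring_sum:
  "AE_function_ring S \<Longrightarrow> (\<And>i. i \<in> I \<Longrightarrow> f i \<in> S) \<Longrightarrow> (\<lambda>\<zeta>. \<Sum>i\<in>I. f i \<zeta>) \<in> S"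
  by (induction I rule: infinite_finite_induct)
    (auto intro: AE_function_ring_const AE_function_ring_add)

lemma AE_function_ring_prod:
  "AE_function_ring S \<Longrightarrow> (\<And>i. i \<in> I \<Longrightarrow> f i \<in> S) \<Longrightarrow> (\<lambda>\<zeta>. \<Prod>i\<in>I. f i \<zeta>) \<in> S"
  by (induction I rule: infinite_finite_induct)
    (auto intro: AE_function_ring_const AE_function_ring_mult)

lemma AE_function_ring_det:
  fixes A :: "complex \<Rightarrow> complex^'n^'n"
  assumes "AE_function_ring S" "\<And>i j. (\<lambda>\<zeta>. A \<zeta> $ i $ j) \<in> S"
  shows "(\<lambda>\<zeta>. det (A \<zeta>)) \<in> S"
  unfolding det_def using assms
  by (intro AE_function_ring_sum AE_function_ring_prod AE_function_ring_mult AE_function_ring_const)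

lemma invertible_matrix_inv:
  fixes A :: "'a::field^'n^'n"
  assumes "invertible A"
  shows "A ** matrix_inv A = mat 1" "matrix_inv A ** A = mat 1"
  using someI_ex[OF assms[unfolded invertible_def]] unfolding matrix_inv_def by auto

text \<open>Column \<open>j\<close> of the inverse solves the linear system with right-hand side
  \<open>axis j 1\<close>; this is Cramer's rule for that system.\<close>

lemma matrix_inv_component:
  fixes A :: "'a::field^'n^'n"
  assumes "det A \<noteq> 0"
  shows "matrix_inv A $ k $ j = det (\<chi> i l. if l = k then axis j 1 $ i else A $ i $ l) / det A"
proof -
  have "A *v (matrix_inv A *v axis j 1) = axis j 1"
    using invertible_matrix_inv(1)[of A] assms
    by (simp add: invertible_det_nz matrix_vector_mul_assoc)
  then have "matrix_inv A *v axis j 1 = (\<chi> k. det (\<chi> i l. if l = k then axis j 1 $ i else A $ i $ l) / det A)"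
    using cramer[OF assms] by blast
  then have "(matrix_inv A *v axis j 1) $ k = det (\<chi> i l. if l = k then axis j 1 $ i else A $ i $ l) / det A"
    by simp
  then show ?thesis
    by (simp add: matrix_vector_mult_def axis_def if_distrib cong: if_cong)
qed

text \<open>The theorem prescribes the inverse of the right factor, so that factor is taken to be
  \<open>matrix_inv H\<close>, and \<open>H\<close> has to be recovered from it.\<close>

lemma matrix_inv_matrix_inv:
  fixes A :: "'a::field^'n^'n"
  assumes "invertible A"
  shows "invertible (matrix_inv A)" "matrix_inv (matrix_inv A) = A"
proof -
  show inv: "invertible (matrix_inv A)"
    using invertible_matrix_inv[OF assms] unfolding invertible_def by blast
  have "matrix_inv (matrix_inv A) = (A ** matrix_inv A) ** matrix_inv (matrix_inv A)"
    by (simp add: invertible_matrix_inv[OF assms] matrix_mul_lid)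
  also have "\<dots> = A"
    using invertible_matrix_inv[OF inv] by (simp add: matrix_mul_assoc[symmetric] matrix_mul_rid)
  finally show "matrix_inv (matrix_inv A) = A" .
qed

text \<open>Because the determinant is a nonzero constant, the division in Cramer's rule is
  multiplication by a scalar, and no function in the algebra has to be inverted.\<close>

lemma entries_in_matrix_inv:
  assumes S: "AE_function_ring S" and A: "entries_in S A"
    and det: "AE \<zeta> in arc_measure. det (A \<zeta>) = c" and c: "c \<noteq> 0"
  shows "entries_in S (\<lambda>\<zeta>. matrix_inv (A \<zeta>))"
  unfolding entries_in_def
proof (intro allI)
  fix k j
  let ?D = "\<lambda>\<zeta>. det (\<chi> i l. if l = k then axis j 1 $ i else A \<zeta> $ i $ l)"
  have "(\<lambda>\<zeta>. if l = k then axis j 1 $ i else A \<zeta> $ i $ l) \<in> S" for i l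
    using A S by (cases "l = k") (auto simp: entries_in_def intro: AE_function_ring_const)
  then have "?D \<in> S"
    by (intro AE_function_ring_det[OF S]) simp
  then have "(\<lambda>\<zeta>. ?D \<zeta> * inverse c) \<in> S"
    by (intro AE_function_ring_mult[OF S] AE_function_ring_const[OF S])
  then show "(\<lambda>\<zeta>. matrix_inv (A \<zeta>) $ k $ j) \<in> S"
  proof (rule AE_function_ring_cong[OF S])
    show "AE \<zeta> in arc_measure. ?D \<zeta> * inverse c = matrix_inv (A \<zeta>) $ k $ j"
      using det by eventually_elim (use c in \<open>simp add: matrix_inv_component field_simps\<close>)
  qed
qed

lemma AE_function_ring_Hinf: "AE_function_ring Hinf"
  unfolding AE_function_ring_def using Hinf_cong_AE by blast

lemma AE_function_ring_conj_Hinf: "AE_function_ring conj_Hinf"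
  unfolding AE_function_ring_def conj_Hinf_def
  by (auto intro: Hinf_cong_AE)

lemma canonical_factorization_from_inverse:
  assumes G: "entries_in Linf G" and Gm: "entries_in conj_Hinf Gm" and H: "entries_in Hinf H"
    and eq: "AE \<zeta> in arc_measure. G \<zeta> ** H \<zeta> = Gm \<zeta>"
    and det: "AE \<zeta> in arc_measure. det (G \<zeta>) = 1" "AE \<zeta> in arc_measure. det (H \<zeta>) = c" and c: "c \<noteq> 0"
  shows "bounded_canonical_factorization G Gm (\<lambda>\<zeta>. matrix_inv (H \<zeta>))"
    and "AE \<zeta> in arc_measure. matrix_inv (matrix_inv (H \<zeta>)) = H \<zeta>"
    and "AE \<zeta> in arc_measure. det (Gm \<zeta>) = c"
proof -
  show detm: "AE \<zeta> in arc_measure. det (Gm \<zeta>) = c"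
    using eq det by eventually_elim (metis det_mul mult_1)
  show inv: "AE \<zeta> in arc_measure. matrix_inv (matrix_inv (H \<zeta>)) = H \<zeta>"
    using det(2) by eventually_elim (use c in \<open>simp add: matrix_inv_matrix_inv invertible_det_nz\<close>)
  have "AE \<zeta> in arc_measure. G \<zeta> = Gm \<zeta> ** matrix_inv (H \<zeta>)"
    using eq det(2)
  proof eventually_elim
    case (elim \<zeta>)
    then have "invertible (H \<zeta>)" using c by (simp add: invertible_det_nz)
    then show ?case
      unfolding elim(1)[symmetric] by (simp add: matrix_mul_assoc[symmetric] invertible_matrix_inv matrix_mul_rid)
  qed
  moreover have "AE \<zeta> in arc_measure. invertible (Gm \<zeta>) \<and> invertible (matrix_inv (H \<zeta>))"
    using det(2) detm by eventually_elim (metis c invertible_det_nz matrix_inv_matrix_inv(1))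
  moreover have "entries_in conj_Hinf (\<lambda>\<zeta>. matrix_inv (Gm \<zeta>))"
    by (rule entries_in_matrix_inv[OF AE_function_ring_conj_Hinf Gm detm c])
  moreover have "entries_in Hinf (\<lambda>\<zeta>. matrix_inv (H \<zeta>))"
    by (rule entries_in_matrix_inv[OF AE_function_ring_Hinf H det(2) c])
  moreover have "entries_in Hinf (\<lambda>\<zeta>. matrix_inv (matrix_inv (H \<zeta>)))"
    unfolding entries_in_def
  proof (intro allI)
    fix i j
    have "(\<lambda>\<zeta>. H \<zeta> $ i $ j) \<in> Hinf" using H by (simp add: entries_in_def)
    then show "(\<lambda>\<zeta>. matrix_inv (matrix_inv (H \<zeta>)) $ i $ j) \<in> Hinf"
      by (rule Hinf_cong_AE) (use inv in eventually_elim, simp)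
  qed
  ultimately show "bounded_canonical_factorization G Gm (\<lambda>\<zeta>. matrix_inv (H \<zeta>))"
    using G Gm unfolding bounded_canonical_factorization_def by blast
qed

section \<open>Membership of the entries in the conjugate algebra\<close>

lemma cnj_sphere: "cmod \<zeta> = 1 \<Longrightarrow> cnj \<zeta> = 1 / \<zeta>"
  using complex_norm_square[of \<zeta>] by (auto simp: eq_divide_eq mult.commute)

text \<open>On the circle the conjugate of \<open>(\<zeta> - c) * q\<close> is
  \<open>Q / \<zeta> - cnj c * Q\<close> in boundary values. The first term is the difference
  quotient of \<open>Q\<close> at 0, since \<open>Q 0 = 0\<close>.\<close>

lemma conj_Hinf_shift_vanishing:
  assumes Q: "analytic_extension Q (\<lambda>\<zeta>. cnj (q \<zeta>))" and 0: "Q 0 = 0"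
  shows "(\<lambda>\<zeta>. (\<zeta> - c) * q \<zeta>) \<in> conj_Hinf"
proof -
  have q: "(\<lambda>\<zeta>. cnj (q \<zeta>)) \<in> Hinf" using Q by (auto simp: Hinf_def)
  have "(\<lambda>\<zeta>. (cnj (q \<zeta>) - Q 0) / (\<zeta> - 0)) \<in> Hinf"
    using Q by (rule Hinf_difference_quotient) simp
  then have "(\<lambda>\<zeta>. (cnj (q \<zeta>) - Q 0) / (\<zeta> - 0) - cnj c * cnj (q \<zeta>)) \<in> Hinf"
    using q by (intro AE_function_ring_diff AE_function_ring_Hinf AE_function_ring_mult AE_function_ring_const)
  then have "(\<lambda>\<zeta>. cnj ((\<zeta> - c) * q \<zeta>)) \<in> Hinf"
  proof (rule Hinf_cong_AE)
    show "AE \<zeta> in arc_measure. (cnj (q \<zeta>) - Q 0) / (\<zeta> - 0) - cnj c * cnj (q \<zeta>) = cnj ((\<zeta> - c) * q \<zeta>)"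
      using AE_arc_measure_sphere
    proof eventually_elim
      case (elim \<zeta>)
      then show ?case using 0 by (simp add: cnj_sphere algebra_simps)
    qed
  qed
  then show ?thesis by (simp add: conj_Hinf_def)
qed

lemma inner_quotients:
  assumes \<theta>: "inner_function \<theta>" and lam: "lam \<in> ball 0 1 \<or> lam \<in> T_ADC \<theta> - boundary_spectrum \<theta>"
  shows inner_quotient_Hinf: "(\<lambda>z. (\<theta> z - value_at \<theta> lam) / (z - lam)) \<in> Hinf"
    and inner_quotient_conj_Hinf: "(\<lambda>z. (1 - value_at \<theta> lam * cnj (\<theta> z)) / (z - lam)) \<in> conj_Hinf"
proof -
  have H: "\<theta> \<in> Hinf" and uni: "unimodular \<theta>" using \<theta> by (auto simp: inner_function_def)
  note F = analytic_extension_disc_ext[OF H]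
  let ?w = "value_at \<theta> lam"
  have 1: "(\<lambda>z. (\<theta> z - ?w) / (z - lam)) \<in> Hinf \<and>
     (\<lambda>z. cnj ((1 - ?w * cnj (\<theta> z)) / (z - lam))) \<in> Hinf"
  proof (cases "lam \<in> ball 0 1")
    case True
    then have w: "?w = disc_ext \<theta> lam" by (simp add: value_at_def)
    \<comment> \<open>Uniform on the closed disc, so the Cauchy kernel of an interior point is a
      bounded analytic function with continuous boundary values.\<close>
    have nz: "1 - cmod lam \<le> cmod (1 - cnj lam * z)" if "cmod z \<le> 1" for z
    proof -
      have "cmod (cnj lam * z) \<le> cmod lam"
        using that by (simp add: norm_mult mult_left_le)
      then show ?thesis using norm_triangle_ineq2[of 1 "cnj lam * z"] by simp
    qed
    have nz': "1 - cnj lam * z \<noteq> 0" if "cmod z \<le> 1" for z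
      using nz[OF that] True by auto
    have "analytic_extension (\<lambda>z. inverse (1 - cnj lam * z)) (\<lambda>z. inverse (1 - cnj lam * z))"
    proof (rule analytic_extensionI)
      show "(\<lambda>z. inverse (1 - cnj lam * z)) holomorphic_on ball 0 1"
        using nz' by (intro holomorphic_intros) auto
      show "cmod (inverse (1 - cnj lam * z)) \<le> inverse (1 - cmod lam)" if "cmod z < 1" for z
        using nz[of z] that True by (simp add: norm_inverse le_imp_inverse_le)
      show "AE \<zeta> in arc_measure. ((\<lambda>z. inverse (1 - cnj lam * z)) \<longlongrightarrow> inverse (1 - cnj lam * \<zeta>)) (nontangential \<zeta>)"
        using AE_arc_measure_sphere
        by eventually_elim (use nz' in \<open>auto intro!: tendsto_intros nontangential_ident\<close>)
    qed
    then have inv: "(\<lambda>z. inverse (1 - cnj lam * z)) \<in> Hinf" by (auto simp: Hinf_def)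
    \<comment> \<open>Obtained by conjugating the second quotient on the circle, where
      \<open>cnj z = 1 / z\<close>. The new denominator has no zero in the closed disc, so the
      numerator need not vanish anywhere.\<close>
    have "(\<lambda>z. z * (1 - cnj ?w * \<theta> z) * inverse (1 - cnj lam * z)) \<in> Hinf"
      by (intro AE_function_ring_mult[OF AE_function_ring_Hinf] AE_function_ring_diff[OF AE_function_ring_Hinf]
          Hinf_const Hinf_ident H inv)
    then have "(\<lambda>z. cnj ((1 - ?w * cnj (\<theta> z)) / (z - lam))) \<in> Hinf"
    proof (rule Hinf_cong_AE)
      show "AE z in arc_measure. z * (1 - cnj ?w * \<theta> z) * inverse (1 - cnj lam * z) =
          cnj ((1 - ?w * cnj (\<theta> z)) / (z - lam))"
        using AE_arc_measure_sphere
      proof eventually_elim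
        case (elim z)
        have z: "z \<noteq> 0" using elim by auto
        have "cnj z = 1 / z" using elim by (simp add: cnj_sphere)
        then have "cnj z - cnj lam = (1 - cnj lam * z) / z" using z by (simp add: field_simps)
        then show ?case by (simp add: divide_inverse mult_ac)
      qed
    qed
    then show ?thesis using Hinf_difference_quotient[OF F True] w by simp
  next
    case False
    then have lamT: "lam \<in> T_ADC \<theta>" "lam \<notin> boundary_spectrum \<theta>" using lam by auto
    then have sph: "lam \<in> sphere 0 1" and n: "cmod lam = 1" by (auto simp: T_ADC_def)
    obtain w where w: "(disc_ext \<theta> \<longlongrightarrow> w) (nontangential lam)" "cmod w = 1"
      using lamT(1) by (auto simp: T_ADC_def)
    have v: "?w = w"
      using tendsto_Lim[OF nontangential_neq_bot[OF n] w(1)] n by (simp add: value_at_def)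
    obtain c r where cr: "c > 0" "r > 0"
      "\<And>z. cmod z < 1 \<Longrightarrow> cmod (z - lam) < r \<Longrightarrow> c \<le> cmod (disc_ext \<theta> z)"
      by (rule not_boundary_spectrumE[OF sph lamT(2)]) (rule that)
    have k: "(\<lambda>z. (\<theta> z - w) / (z - lam)) \<in> Hinf"
      by (rule Hinf_boundary_quotient[OF F uni n w(1) cr(1,2)]) (erule (1) cr(3))
    \<comment> \<open>For unimodular \<open>lam\<close> and \<open>w\<close>, conjugation turns the
      second quotient into a constant times \<open>z\<close> times the first, so one boundedness
      result serves both.\<close>
    then have "(\<lambda>z. lam * cnj w * z * ((\<theta> z - w) / (z - lam))) \<in> Hinf"
      by (intro AE_function_ring_mult[OF AE_function_ring_Hinf] Hinf_const Hinf_ident)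
    then have "(\<lambda>z. cnj ((1 - ?w * cnj (\<theta> z)) / (z - lam))) \<in> Hinf"
    proof (rule Hinf_cong_AE)
      show "AE z in arc_measure. lam * cnj w * z * ((\<theta> z - w) / (z - lam)) =
          cnj ((1 - ?w * cnj (\<theta> z)) / (z - lam))"
        using AE_arc_measure_sphere AE_arc_measure_neq[of lam]
      proof eventually_elim
        case (elim z)
        have z: "z \<noteq> 0" "lam \<noteq> 0" "w \<noteq> 0" using elim n w by auto
        have c: "cnj z = 1 / z" "cnj lam = 1 / lam" "cnj w = 1 / w" using elim n w by (simp_all add: cnj_sphere)
        have "cnj ((1 - ?w * cnj (\<theta> z)) / (z - lam)) = (1 - \<theta> z / w) / (1 / z - 1 / lam)"
          by (simp add: v c)
        also have "\<dots> = lam * cnj w * z * ((\<theta> z - w) / (z - lam))"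
          using z elim(2) by (simp add: c divide_simps) (simp add: algebra_simps)
        finally show ?case ..
      qed
    qed
    then show ?thesis using k v by simp
  qed
  then show "(\<lambda>z. (\<theta> z - ?w) / (z - lam)) \<in> Hinf"
    "(\<lambda>z. (1 - ?w * cnj (\<theta> z)) / (z - lam)) \<in> conj_Hinf"
    by (auto simp: conj_Hinf_def)
qed

section \<open>The two factorizations\<close>

lemma det_vector_4:
  fixes a11 a12 a13 a14 a21 a22 a23 a24 a31 a32 a33 a34 a41 a42 a43 a44 :: "'a::comm_ring_1"
  shows "det (vector [vector [a11, a12, a13, a14], vector [a21, a22, a23, a24],
      vector [a31, a32, a33, a34], vector [a41, a42, a43, a44]] :: 'a^4^4) =
    a11 * (a22 * (a33 * a44 - a34 * a43) - a23 * (a32 * a44 - a34 * a42) + a24 * (a32 * a43 - a33 * a42))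
  - a12 * (a21 * (a33 * a44 - a34 * a43) - a23 * (a31 * a44 - a34 * a41) + a24 * (a31 * a43 - a33 * a41))
  + a13 * (a21 * (a32 * a44 - a34 * a42) - a22 * (a31 * a44 - a34 * a41) + a24 * (a31 * a42 - a32 * a41))
  - a14 * (a21 * (a32 * a43 - a33 * a42) - a22 * (a31 * a43 - a33 * a41) + a23 * (a31 * a42 - a32 * a41))"
proof -
  \<comment> \<open>Side conditions for removing the indices 1, 2, 3 one after another from the sum
    over permutations.\<close>
  have f: "finite {4::4}" "3 \<notin> {4::4}" "finite {3::4, 4}" "2 \<notin> {3::4, 4}"
      "finite {2::4, 3, 4}" "1 \<notin> {2::4, 3, 4}"
    by auto
  show ?thesis
    unfolding det_def UNIV_4
    unfolding sum_over_permutations_insert[OF f(5) f(6)]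
    unfolding sum_over_permutations_insert[OF f(3) f(4)]
    unfolding sum_over_permutations_insert[OF f(1) f(2)]
    unfolding permutes_sing
    by (simp add: sign_swap_id permutation_swap_id permutation_compose sign_compose sign_id swap_id_eq
        algebra_simps)
qed

text \<open>
  At a point \<open>z\<close> of the circle, \<open>d = z - \<lambda>\<close>, \<open>x = \<theta>\<close>, \<open>y = cnj \<theta>\<close>, \<open>p = cnj A\<^sub>+\<close>, \<open>m = A\<^sub>-\<close>,
  \<open>w = \<theta>(\<lambda>)\<close>, \<open>D = \<Delta>\<close>, and \<open>k\<close> is the relevant difference quotient.  The suffix \<open>0\<close> marks the
  case \<open>\<Delta> = 0\<close>.
\<close>

definition symbol_matrix :: "complex \<Rightarrow> complex \<Rightarrow> complex \<Rightarrow> complex \<Rightarrow> complex \<Rightarrow> complex^4^4" where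
  "symbol_matrix d p m x y = vector
     [vector [y, 0, 0, 0],
      vector [0, y, 0, 0],
      vector [d, d * p * y, x, 0],
      vector [d * m * y, d, 0, x]]"

definition right_factor_inv :: "complex \<Rightarrow> complex \<Rightarrow> complex \<Rightarrow> complex \<Rightarrow> complex \<Rightarrow> complex \<Rightarrow> complex \<Rightarrow> complex^4^4" where
  "right_factor_inv a b t D d k x = vector
     [vector [x + a * b * t / D, k, - (a / D), 0],
      vector [- (b / D), 0, x + a * b * t / D, k],
      vector [- d, - 1, 0, 0],
      vector [0, 0, - d, - 1]]"

definition left_factor ::
  "complex \<Rightarrow> complex \<Rightarrow> complex \<Rightarrow> complex \<Rightarrow> complex \<Rightarrow> complex \<Rightarrow> complex \<Rightarrow> complex \<Rightarrow> complex \<Rightarrow> complex \<Rightarrow> complex^4^4"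
where
  "left_factor a b t D w d k p m y = vector
     [vector [1 + a * b * t / D * y, k, - (a / D) * y, 0],
      vector [- (b / D) * y, 0, 1 + a * b * t / D * y, k],
      vector [- (b / D) * d * (p * y - a * t), - w,
              d / D * (p - a + a * b * t * p * (y - t)), p * (1 - w * y)],
      vector [d / D * (m - b + a * b * t * m * (y - t)), m * (1 - w * y),
              - (a / D) * d * (m * y - b * t), - w]]"

definition right_factor_inv0 :: "complex \<Rightarrow> complex \<Rightarrow> complex \<Rightarrow> complex \<Rightarrow> complex \<Rightarrow> complex^4^4" where
  "right_factor_inv0 a t d k x = vector
     [vector [- a * (1 - t * x), k, - a * t, 0],
      vector [x, 0, 1, k],
      vector [- t * a * d, - 1, 0, 0],
      vector [- d, 0, 0, - 1]]"

definition left_factor0 ::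
  "complex \<Rightarrow> complex \<Rightarrow> complex \<Rightarrow> complex \<Rightarrow> complex \<Rightarrow> complex \<Rightarrow> complex \<Rightarrow> complex \<Rightarrow> complex^4^4"
where
  "left_factor0 a t w d k p m y = vector
     [vector [- a * (y - t), k, - a * t * y, 0],
      vector [1, 0, y, k],
      vector [(p - a) * d, - w, (p * y - a * t) * d, p * (1 - w * y)],
      vector [- a * m * (y - t) * d, m * (1 - w * y), (1 - a * t * m * y) * d, - w]]"

lemma det_symbol_matrix: "x * y = 1 \<Longrightarrow> det (symbol_matrix d p m x y) = 1"
  unfolding symbol_matrix_def det_vector_4 by algebra

text \<open>Subtract \<open>d\<close> times column 2 from column 1 and \<open>d\<close> times column
  4 from column 3. By \<open>k * d = x - w\<close> this replaces \<open>x\<close> by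
  \<open>w\<close> and clears the lower entries of columns 1 and 3. What remains is minus the 2x2
  determinant with diagonal \<open>w + a * b * t / D\<close> and off-diagonal entries
  \<open>- a / D\<close> and \<open>- b / D\<close>, free of the point on the circle.\<close>

lemma det_right_factor_inv:
  assumes k: "k * d = x - w" and D: "D = 1 - a * b * t^2" "D \<noteq> 0"
  shows "det (right_factor_inv a b t D d k x) = - ((w^2 - a * b * (1 - t * w)^2) / D)"
proof -
  \<comment> \<open>\<open>inverse D\<close> is treated as an indeterminate subject to this
    relation, which makes the claim a polynomial identity.\<close>
  have "inverse D * (1 - a * b * t^2) = 1" using D by simp
  with k show ?thesis
    unfolding right_factor_inv_def det_vector_4 divide_inverse by algebra
qed

text \<open>Subtracting \<open>t * a * d\<close> times column 2 and \<open>d\<close> times column 4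
  from column 1 turns it into \<open>(- a * (1 - t * w), w, 0, 0)\<close>. Together with column 3
  this leaves a 2x2 determinant as in the other case.\<close>

lemma det_right_factor_inv0:
  assumes "k * d = x - w"
  shows "det (right_factor_inv0 a t d k x) = a * (1 - 2 * t * w)"
  unfolding right_factor_inv0_def det_vector_4 using assms by algebra

text \<open>The quotient \<open>k'\<close> of the left factor is \<open>y * k\<close>, because
  \<open>y * (x - w) = 1 - w * y\<close>. In the lower rows the summands \<open>d * x\<close>
  cancel, and \<open>k * d = x - w\<close> leaves \<open>- w\<close>.\<close>

lemma symbol_matrix_mult_right_factor_inv:
  assumes xy: "x * y = 1" and k: "k * d = x - w" and k': "k' = y * k" and D: "D = 1 - a * b * t^2" "D \<noteq> 0"
  shows "symbol_matrix d p m x y ** right_factor_inv a b t D d k x = left_factor a b t D w d k' p m y"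
proof -
  have "inverse D * (1 - a * b * t^2) = 1" using D by simp
  then show ?thesis
    unfolding symbol_matrix_def right_factor_inv_def left_factor_def divide_inverse k'
      matrix_matrix_mult_def vec_eq_iff forall_4 sum_4 vec_lambda_beta vector_4
    by (intro conjI; use xy k in \<open>algebra | simp add: algebra_simps\<close>)
qed

lemma symbol_matrix_mult_right_factor_inv0:
  assumes xy: "x * y = 1" and k: "k * d = x - w" and k': "k' = y * k"
  shows "symbol_matrix d p m x y ** right_factor_inv0 a t d k x = left_factor0 a t w d k' p m y"
  unfolding symbol_matrix_def right_factor_inv0_def left_factor0_def k'
    matrix_matrix_mult_def vec_eq_iff forall_4 sum_4 vec_lambda_beta vector_4
  by (intro conjI; use xy k in \<open>algebra | simp add: algebra_simps\<close>)

theorem theorem6p18: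
  fixes \<theta> \<phi> \<psi> Ap Am :: "complex \<Rightarrow> complex"
    and lam \<theta>lam a b t \<Delta>lam \<Delta> :: complex
  assumes "inner_function \<theta>"
    and "\<phi> \<in> Linf" and "unimodular \<phi>"
    and "\<psi> \<in> Linf" and "unimodular \<psi>"
    and "Ap \<in> Hinf" and "Am \<in> conj_Hinf"
    and "AE z in arc_measure. cnj (\<psi> z) * \<phi> z = Am z * cnj (\<theta> z) + Ap z * \<theta> z"
    and "\<not> (\<exists>c. AE z in arc_measure. \<phi> z * cnj (\<psi> z) = c * \<theta> z)"
    and "\<not> (\<exists>c. AE z in arc_measure. cnj (\<phi> z) * \<psi> z = c * \<theta> z)"
    and "a = cnj (disc_ext Ap 0)"
    and "b = cnj (disc_ext (\<lambda>z. cnj (Am z)) 0)"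
    and "t = cnj (disc_ext \<theta> 0)"
    and "lam \<in> ball 0 1 \<or> lam \<in> T_ADC \<theta> - boundary_spectrum \<theta>"
    and "\<theta>lam = value_at \<theta> lam"
    and "\<Delta>lam = \<theta>lam ^ 2 - a * b * (1 - t * \<theta>lam) ^ 2"
    and "\<Delta> = 1 - a * b * t ^ 2"
    and "\<Delta>lam \<noteq> 0"
  shows "\<exists>Gm Gp :: complex \<Rightarrow> complex ^ 4 ^ 4.
    bounded_canonical_factorization
      (\<lambda>z. vector
        [vector [cnj (\<theta> z), 0, 0, 0],
         vector [0, cnj (\<theta> z), 0, 0],
         vector [z - lam, (z - lam) * cnj (Ap z) * cnj (\<theta> z), \<theta> z, 0],
         vector [(z - lam) * Am z * cnj (\<theta> z), z - lam, 0, \<theta> z]])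
      Gm Gp \<and>
    (\<Delta> \<noteq> 0 \<longrightarrow>
      (AE z in arc_measure. matrix_inv (Gp z) = vector
        [vector [\<theta> z + a * b * t / \<Delta>, (\<theta> z - \<theta>lam) / (z - lam), - (a / \<Delta>), 0],
         vector [- (b / \<Delta>), 0, \<theta> z + a * b * t / \<Delta>, (\<theta> z - \<theta>lam) / (z - lam)],
         vector [- (z - lam), - 1, 0, 0],
         vector [0, 0, - (z - lam), - 1]]) \<and>
      (AE z in arc_measure. Gm z = vector
        [vector [1 + a * b * t / \<Delta> * cnj (\<theta> z), (1 - \<theta>lam * cnj (\<theta> z)) / (z - lam),
                 - (a / \<Delta>) * cnj (\<theta> z), 0],
         vector [- (b / \<Delta>) * cnj (\<theta> z), 0,
                 1 + a * b * t / \<Delta> * cnj (\<theta> z), (1 - \<theta>lam * cnj (\<theta> z)) / (z - lam)],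
         vector [- (b / \<Delta>) * (z - lam) * (cnj (Ap z) * cnj (\<theta> z) - a * t),
                 - \<theta>lam,
                 (z - lam) / \<Delta> * (cnj (Ap z) - a + a * b * t * cnj (Ap z) * (cnj (\<theta> z) - t)),
                 cnj (Ap z) * (1 - \<theta>lam * cnj (\<theta> z))],
         vector [(z - lam) / \<Delta> * (Am z - b + a * b * t * Am z * (cnj (\<theta> z) - t)),
                 Am z * (1 - \<theta>lam * cnj (\<theta> z)),
                 - (a / \<Delta>) * (z - lam) * (Am z * cnj (\<theta> z) - b * t),
                 - \<theta>lam]]) \<and>
      (AE z in arc_measure. det (matrix_inv (Gp z)) = - (\<Delta>lam / \<Delta>)) \<and>
      (AE z in arc_measure. det (Gm z) = - (\<Delta>lam / \<Delta>)) \<and>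
      - (\<Delta>lam / \<Delta>) \<noteq> 0) \<and>
    (\<Delta> = 0 \<longrightarrow>
      disc_ext Ap 0 \<noteq> 0 \<and> disc_ext (\<lambda>z. cnj (Am z)) 0 \<noteq> 0 \<and> disc_ext \<theta> 0 \<noteq> 0 \<and>
      disc_ext Ap 0 * disc_ext \<theta> 0 = 1 / (disc_ext (\<lambda>z. cnj (Am z)) 0 * disc_ext \<theta> 0) \<and>
      (AE z in arc_measure. matrix_inv (Gp z) = vector
        [vector [- a * (1 - t * \<theta> z), (\<theta> z - \<theta>lam) / (z - lam), - a * t, 0],
         vector [\<theta> z, 0, 1, (\<theta> z - \<theta>lam) / (z - lam)],
         vector [- t * a * (z - lam), - 1, 0, 0],
         vector [- (z - lam), 0, 0, - 1]]) \<and>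
      (AE z in arc_measure. Gm z = vector
        [vector [- a * (cnj (\<theta> z) - t), (1 - \<theta>lam * cnj (\<theta> z)) / (z - lam),
                 - a * t * cnj (\<theta> z), 0],
         vector [1, 0, cnj (\<theta> z), (1 - \<theta>lam * cnj (\<theta> z)) / (z - lam)],
         vector [(cnj (Ap z) - a) * (z - lam),
                 - \<theta>lam,
                 (cnj (Ap z) * cnj (\<theta> z) - a * t) * (z - lam),
                 cnj (Ap z) * (1 - \<theta>lam * cnj (\<theta> z))],
         vector [- a * Am z * (cnj (\<theta> z) - t) * (z - lam),
                 Am z * (1 - \<theta>lam * cnj (\<theta> z)),
                 (1 - a * t * Am z * cnj (\<theta> z)) * (z - lam),
                 - \<theta>lam]]) \<and>
      (AE z in arc_measure. det (matrix_inv (Gp z)) = a * (1 - 2 * t * \<theta>lam)) \<and>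
      (AE z in arc_measure. det (Gm z) = a * (1 - 2 * t * \<theta>lam)) \<and>
      a * (1 - 2 * t * \<theta>lam) = - (\<Delta>lam / b) \<and>
      - (\<Delta>lam / b) \<noteq> 0)"
proof -
  have \<theta>H: "\<theta> \<in> Hinf" and uni: "unimodular \<theta>" and ApH: "Ap \<in> Hinf"
    and AmH: "(\<lambda>z. cnj (Am z)) \<in> Hinf" and AmC: "Am \<in> conj_Hinf"
    and \<theta>lam: "\<theta>lam = value_at \<theta> lam" and \<Delta>: "\<Delta> = 1 - a * b * t^2"
    and \<Delta>lam: "\<Delta>lam = \<theta>lam^2 - a * b * (1 - t * \<theta>lam)^2" "\<Delta>lam \<noteq> 0"
    using assms by (simp_all add: inner_function_def conj_Hinf_def)
  have ext0: "disc_ext Ap 0 = cnj a" "disc_ext (\<lambda>z. cnj (Am z)) 0 = cnj b" "disc_ext \<theta> 0 = cnj t"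
    using assms by simp_all
  note ext = analytic_extension_disc_ext[OF \<theta>H] analytic_extension_disc_ext[OF ApH]
    analytic_extension_disc_ext[OF AmH] analytic_extension_const
    analytic_extension_diff analytic_extension_add analytic_extension_mult
  have k: "(\<lambda>z. (\<theta> z - \<theta>lam) / (z - lam)) \<in> Hinf"
    and kc: "(\<lambda>z. (1 - \<theta>lam * cnj (\<theta> z)) / (z - lam)) \<in> conj_Hinf"
    unfolding \<theta>lam using assms by (auto intro: inner_quotients)
  have \<theta>C: "(\<lambda>z. cnj (\<theta> z)) \<in> conj_Hinf" and ApC: "(\<lambda>z. cnj (Ap z)) \<in> conj_Hinf"
    using \<theta>H ApH by (simp_all add: conj_Hinf_def)
  note ringH = AE_function_ring_const[OF AE_function_ring_Hinf] AE_function_ring_diff[OF AE_function_ring_Hinf]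
    AE_function_ring_add[OF AE_function_ring_Hinf] AE_function_ring_mult[OF AE_function_ring_Hinf]
    AE_function_ring_minus[OF AE_function_ring_Hinf]
  note constC = AE_function_ring_const[OF AE_function_ring_conj_Hinf]
  note multC = AE_function_ring_mult[OF AE_function_ring_conj_Hinf]
  note ringC = constC AE_function_ring_diff[OF AE_function_ring_conj_Hinf]
    AE_function_ring_add[OF AE_function_ring_conj_Hinf] multC
    AE_function_ring_minus[OF AE_function_ring_conj_Hinf]
  \<comment> \<open>The two pointwise facts behind the matrix identities: the first is
    \<open>x * y = 1\<close>, the second allows cancelling z - \<lambda> in
    \<open>k * d = x - w\<close>.\<close>
  have AE\<theta>: "AE z in arc_measure. \<theta> z * cnj (\<theta> z) = 1 \<and> z \<noteq> lam"
    using uni[unfolded unimodular_def] AE_arc_measure_neq[of lam]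
  proof eventually_elim
    case (elim z)
    then show ?case using complex_norm_square[of "\<theta> z"] by simp
  qed
  define G where "G z = symbol_matrix (z - lam) (cnj (Ap z)) (Am z) (\<theta> z) (cnj (\<theta> z))" for z
  have GL: "entries_in Linf G"
  proof -
    have "(\<lambda>z. z - lam) \<in> Linf" by (intro Hinf_Linf ringH Hinf_ident)
    moreover note Hinf_Linf[OF Hinf_const] Hinf_Linf[OF \<theta>H] conj_Hinf_Linf[OF \<theta>C] conj_Hinf_Linf[OF ApC] conj_Hinf_Linf[OF AmC]
    ultimately show ?thesis
      unfolding entries_in_def G_def symbol_matrix_def forall_4 vector_4
      by (intro conjI Linf_mult)
  qed
  have detG: "AE z in arc_measure. det (G z) = 1"
    using AE\<theta> by eventually_elim (simp add: G_def det_symbol_matrix)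
  show ?thesis
  proof (cases "\<Delta> = 0")
    case False
    define H where "H z = right_factor_inv a b t \<Delta> (z - lam) ((\<theta> z - \<theta>lam) / (z - lam)) (\<theta> z)" for z
    define M where "M z = left_factor a b t \<Delta> \<theta>lam (z - lam) ((1 - \<theta>lam * cnj (\<theta> z)) / (z - lam))
        (cnj (Ap z)) (Am z) (cnj (\<theta> z))" for z
    have HH: "entries_in Hinf H"
      unfolding entries_in_def H_def right_factor_inv_def forall_4 vector_4
      by (intro conjI; (rule k \<theta>H Hinf_ident ringH)+)
    \<comment> \<open>In this and the following memberships the witness is the conjugate of the
      second factor, with every boundary function replaced by its disc extension;
      \<open>ext0\<close> evaluates it to 0 at the origin.\<close>
    have "(\<lambda>z. (z - lam) * (cnj (Ap z) * cnj (\<theta> z) - a * t)) \<in> conj_Hinf"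
      by (rule conj_Hinf_shift_vanishing[of "\<lambda>z. disc_ext Ap z * disc_ext \<theta> z - cnj a * cnj t"])
        (simp_all add: ext ext0)
    then have e31: "(\<lambda>z. - (b / \<Delta>) * (z - lam) * (cnj (Ap z) * cnj (\<theta> z) - a * t)) \<in> conj_Hinf"
      unfolding mult.assoc[of _ "_ - lam"] by (rule multC[OF constC])
    have "(\<lambda>z. (z - lam) * (Am z * cnj (\<theta> z) - b * t)) \<in> conj_Hinf"
      by (rule conj_Hinf_shift_vanishing[of "\<lambda>z. disc_ext (\<lambda>z. cnj (Am z)) z * disc_ext \<theta> z - cnj b * cnj t"])
        (simp_all add: ext ext0)
    then have e43: "(\<lambda>z. - (a / \<Delta>) * (z - lam) * (Am z * cnj (\<theta> z) - b * t)) \<in> conj_Hinf"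
      unfolding mult.assoc[of _ "_ - lam"] by (rule multC[OF constC])
    have "(\<lambda>z. (z - lam) * (cnj (Ap z) - a + a * b * t * cnj (Ap z) * (cnj (\<theta> z) - t))) \<in> conj_Hinf"
      by (rule conj_Hinf_shift_vanishing[of "\<lambda>z. disc_ext Ap z - cnj a + cnj a * cnj b * cnj t * disc_ext Ap z * (disc_ext \<theta> z - cnj t)"])
        (simp_all add: ext ext0)
    then have e33: "(\<lambda>z. (z - lam) / \<Delta> * (cnj (Ap z) - a + a * b * t * cnj (Ap z) * (cnj (\<theta> z) - t))) \<in> conj_Hinf"
      unfolding divide_inverse mult.commute[of _ "inverse \<Delta>"] mult.assoc[of "inverse \<Delta>"] by (rule multC[OF constC])
    have "(\<lambda>z. (z - lam) * (Am z - b + a * b * t * Am z * (cnj (\<theta> z) - t))) \<in> conj_Hinf"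
      by (rule conj_Hinf_shift_vanishing[of "\<lambda>z. disc_ext (\<lambda>z. cnj (Am z)) z - cnj b + cnj a * cnj b * cnj t * disc_ext (\<lambda>z. cnj (Am z)) z * (disc_ext \<theta> z - cnj t)"])
        (simp_all add: ext ext0)
    then have e41: "(\<lambda>z. (z - lam) / \<Delta> * (Am z - b + a * b * t * Am z * (cnj (\<theta> z) - t))) \<in> conj_Hinf"
      unfolding divide_inverse mult.commute[of _ "inverse \<Delta>"] mult.assoc[of "inverse \<Delta>"] by (rule multC[OF constC])
    have MC: "entries_in conj_Hinf M"
      unfolding entries_in_def M_def left_factor_def forall_4 vector_4
      by (intro conjI; (rule e31 e33 e41 e43 kc \<theta>C ApC AmC ringC)+)
    have eq: "AE z in arc_measure. G z ** H z = M z"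
      using AE\<theta>
    proof eventually_elim
      case (elim z)
      then have "(1 - \<theta>lam * cnj (\<theta> z)) / (z - lam) = cnj (\<theta> z) * ((\<theta> z - \<theta>lam) / (z - lam))"
        by (simp add: field_simps)
      then show ?case
        unfolding G_def H_def M_def using elim False \<Delta>
        by (intro symbol_matrix_mult_right_factor_inv) auto
    qed
    have detH: "AE z in arc_measure. det (H z) = - (\<Delta>lam / \<Delta>)"
      using AE\<theta>
    proof eventually_elim
      case (elim z)
      then show ?case
        unfolding H_def \<Delta>lam(1) using False \<Delta> by (intro det_right_factor_inv) auto
    qed
    have nz: "- (\<Delta>lam / \<Delta>) \<noteq> 0" using False \<Delta>lam(2) by simp
    note fact = canonical_factorization_from_inverse[OF GL MC HH eq detG detH nz]
    \<comment> \<open>The right factor is \<open>matrix_inv H\<close>, so the inverse prescribed for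
      it is a double inverse.\<close>
    have inv: "AE z in arc_measure. matrix_inv (matrix_inv (H z)) =
        right_factor_inv a b t \<Delta> (z - lam) ((\<theta> z - \<theta>lam) / (z - lam)) (\<theta> z)"
      using fact(2) unfolding H_def .
    have detinv: "AE z in arc_measure. det (matrix_inv (matrix_inv (H z))) = - (\<Delta>lam / \<Delta>)"
      using fact(2) detH by eventually_elim simp
    have M: "AE z in arc_measure. M z = left_factor a b t \<Delta> \<theta>lam (z - lam)
        ((1 - \<theta>lam * cnj (\<theta> z)) / (z - lam)) (cnj (Ap z)) (Am z) (cnj (\<theta> z))"
      unfolding M_def by simp
    show ?thesis
      by (rule exI[of _ M], rule exI[of _ "\<lambda>z. matrix_inv (H z)"], intro conjI impI)
        (rule fact(1)[unfolded G_def symbol_matrix_def] inv[unfolded right_factor_inv_def]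
            M[unfolded left_factor_def] detinv fact(3) nz | erule notE[OF False])+
  next
    case True
    then have abt: "a * b * t^2 = 1" using \<Delta> by simp
    then have nz0: "a \<noteq> 0" "b \<noteq> 0" "t \<noteq> 0" by auto
    have cabt: "cnj a * cnj b * (cnj t)^2 = 1"
      using arg_cong[OF abt, of cnj] by simp
    define H where "H z = right_factor_inv0 a t (z - lam) ((\<theta> z - \<theta>lam) / (z - lam)) (\<theta> z)" for z
    define M where "M z = left_factor0 a t \<theta>lam (z - lam) ((1 - \<theta>lam * cnj (\<theta> z)) / (z - lam))
        (cnj (Ap z)) (Am z) (cnj (\<theta> z))" for z
    have HH: "entries_in Hinf H"
      unfolding entries_in_def H_def right_factor_inv0_def forall_4 vector_4
      by (intro conjI; (rule k \<theta>H Hinf_ident ringH)+)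
    have "(\<lambda>z. (z - lam) * (cnj (Ap z) - a)) \<in> conj_Hinf"
      by (rule conj_Hinf_shift_vanishing[of "\<lambda>z. disc_ext Ap z - cnj a"]) (simp_all add: ext ext0)
    then have e31: "(\<lambda>z. (cnj (Ap z) - a) * (z - lam)) \<in> conj_Hinf"
      by (simp only: mult.commute)
    have "(\<lambda>z. (z - lam) * (cnj (Ap z) * cnj (\<theta> z) - a * t)) \<in> conj_Hinf"
      by (rule conj_Hinf_shift_vanishing[of "\<lambda>z. disc_ext Ap z * disc_ext \<theta> z - cnj a * cnj t"])
        (simp_all add: ext ext0)
    then have e33: "(\<lambda>z. (cnj (Ap z) * cnj (\<theta> z) - a * t) * (z - lam)) \<in> conj_Hinf"
      by (simp only: mult.commute)
    have "(\<lambda>z. (z - lam) * (- a * Am z * (cnj (\<theta> z) - t))) \<in> conj_Hinf"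
      by (rule conj_Hinf_shift_vanishing[of "\<lambda>z. - cnj a * disc_ext (\<lambda>z. cnj (Am z)) z * (disc_ext \<theta> z - cnj t)"])
        (simp_all only: complex_cnj_mult complex_cnj_minus complex_cnj_diff complex_cnj_cnj ext ext0, simp)
    then have e41: "(\<lambda>z. - a * Am z * (cnj (\<theta> z) - t) * (z - lam)) \<in> conj_Hinf"
      by (simp only: mult.commute)
    \<comment> \<open>Here the value at the origin is the conjugate of
      \<open>1 - a * b * t^2\<close>, so vanishing is exactly the condition \<Delta> = 0.\<close>
    have "(\<lambda>z. (z - lam) * (1 - a * t * Am z * cnj (\<theta> z))) \<in> conj_Hinf"
      by (rule conj_Hinf_shift_vanishing[of "\<lambda>z. 1 - cnj a * cnj t * disc_ext (\<lambda>z. cnj (Am z)) z * disc_ext \<theta> z"])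
        (use cabt in \<open>simp_all add: ext ext0 power2_eq_square mult_ac\<close>)
    then have e43: "(\<lambda>z. (1 - a * t * Am z * cnj (\<theta> z)) * (z - lam)) \<in> conj_Hinf"
      by (simp only: mult.commute)
    have MC: "entries_in conj_Hinf M"
      unfolding entries_in_def M_def left_factor0_def forall_4 vector_4
      by (intro conjI; (rule e31 e33 e41 e43 kc \<theta>C ApC AmC ringC)+)
    have eq: "AE z in arc_measure. G z ** H z = M z"
      using AE\<theta>
    proof eventually_elim
      case (elim z)
      then have "(1 - \<theta>lam * cnj (\<theta> z)) / (z - lam) = cnj (\<theta> z) * ((\<theta> z - \<theta>lam) / (z - lam))"
        by (simp add: field_simps)
      then show ?case
        unfolding G_def H_def M_def using elim
        by (intro symbol_matrix_mult_right_factor_inv0) auto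
    qed
    have detH: "AE z in arc_measure. det (H z) = a * (1 - 2 * t * \<theta>lam)"
      using AE\<theta>
    proof eventually_elim
      case (elim z)
      then show ?case unfolding H_def by (intro det_right_factor_inv0) auto
    qed
    \<comment> \<open>With \<open>a * b * t^2 = 1\<close> the squares of \<theta>(\<lambda>) cancel
      in \<Delta>lam, leaving an expression linear in \<theta>(\<lambda>).\<close>
    have "a * (1 - 2 * t * \<theta>lam) * b = - \<Delta>lam"
      unfolding \<Delta>lam(1) using abt by algebra
    then have val: "a * (1 - 2 * t * \<theta>lam) = - (\<Delta>lam / b)"
      using nz0 by (simp add: field_simps)
    have nz': "- (\<Delta>lam / b) \<noteq> 0" using nz0 \<Delta>lam(2) by simp
    then have nz: "a * (1 - 2 * t * \<theta>lam) \<noteq> 0" unfolding val .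
    note fact = canonical_factorization_from_inverse[OF GL MC HH eq detG detH nz]
    have inv: "AE z in arc_measure. matrix_inv (matrix_inv (H z)) =
        right_factor_inv0 a t (z - lam) ((\<theta> z - \<theta>lam) / (z - lam)) (\<theta> z)"
      using fact(2) unfolding H_def .
    have detinv: "AE z in arc_measure. det (matrix_inv (matrix_inv (H z))) = a * (1 - 2 * t * \<theta>lam)"
      using fact(2) detH by eventually_elim simp
    have M: "AE z in arc_measure. M z = left_factor0 a t \<theta>lam (z - lam)
        ((1 - \<theta>lam * cnj (\<theta> z)) / (z - lam)) (cnj (Ap z)) (Am z) (cnj (\<theta> z))"
      unfolding M_def by simp
    have vals: "disc_ext Ap 0 \<noteq> 0" "disc_ext (\<lambda>z. cnj (Am z)) 0 \<noteq> 0" "disc_ext \<theta> 0 \<noteq> 0"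
      "disc_ext Ap 0 * disc_ext \<theta> 0 = 1 / (disc_ext (\<lambda>z. cnj (Am z)) 0 * disc_ext \<theta> 0)"
      unfolding ext0 using nz0 cabt by (simp_all add: field_simps power2_eq_square)
    show ?thesis
      by (rule exI[of _ M], rule exI[of _ "\<lambda>z. matrix_inv (H z)"], intro conjI impI)
        (rule fact(1)[unfolded G_def symbol_matrix_def] inv[unfolded right_factor_inv0_def]
            M[unfolded left_factor0_def] detinv fact(3) vals val nz' | erule notE[OF _ True])+
  qed
qed

end
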